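(* Let $X\in L^1(\mathbb{P}_0)$, let $\phi_1,\phi_2\in\Phi_0$ be lower-semicontinuous, let $r>0$, and assume the distribution of $X$ under $\mathbb{P}_0$ has a real-valued density function $f_0$. Define the robust shortfall risk measure $$\rho^s_{\mathrm{sf},\mathbb{P}_0}(X)=\sup_{\lambda >0}\ \sup_{\{\mathbb{Q}: I_{\phi_2}(\mathbb{Q}, \mathbb{P}_0)\leq r\}}\ \sup_{\{\bar{\mathbb{Q}}:\bar{\mathbb{Q}}\ll \mathbb{Q}\}}\mathbb{E}_{\bar{\mathbb{Q}}}[-X]-I_{\phi^\lambda_1}(\bar{\mathbb{Q}},\mathbb{Q}),\qquad \phi_1^\lambda(t)=\lambda\phi_1(t/\lambda).$$ Then $\rho^s_{\mathrm{sf},\mathbb{P}_0}(X)$ is finite if and only if there exist $\theta_1,\theta_2\in\mathbb{R}$ and $\eta\ge0$ such that $$\int_{\mathbb{R}} \eta\, \phi_2^*\left(\frac{\phi_1^*(-\theta_2-x)+\theta_1}{\eta}\right)f_0(x)\,\mathrm{d}x\leq \theta_1- \eta r.$$ Moreover, $$\rho^s_{\mathrm{sf},\mathbb{P}_0}(X)=\inf_{\eta\geq 0,\ \theta_1,\theta_2\in\mathbb{R}}\left\{\theta_2\ \middle|\ \mathbb{E}_{\mathbb{P}_0}\left[\eta\, \phi_2^*\left(\frac{\phi_1^*(-\theta_2-X)+\theta_1}{\eta}\right)\right]\leq\theta_1- \eta r\right\}.$$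
   Context: $\mathbb{P}_0$ is a given (nominal) probability measure on a measurable space $(\Omega,\mathcal{F})$; $\mathbb{Q},\bar{\mathbb{Q}}$ range over probability measures. Densities are with respect to a $\sigma$-finite measure $\mathrm{d}x$ on $\mathbb{R}$ (e.g. Lebesgue measure). $\Phi_0$ is the set of all convex functions $\phi:\mathbb{R}\to[0,\infty]$ with $\phi(1)=0$ whose effective domain $\{t:\phi(t)<\infty\}$ is contained in $[0,\infty)$ and contains a neighborhood of $1$. For a convex function $\phi$ (including $\phi=\phi_1^\lambda$), $I_\phi(\mathbb{Q},\mathbb{P})=\int_\Omega\phi\left(\frac{\mathrm{d}\mathbb{Q}}{\mathrm{d}\mathbb{P}}\right)\mathrm{d}\mathbb{P}$ if $\mathbb{Q}\ll\mathbb{P}$, and $+\infty$ otherwise. Conventions: $\phi(0)=\lim_{t\downarrow0}\phi(t)$, $0\phi(0/0)=0$, $0\phi(a/0)=a\lim_{t\to\infty}\phi(t)/t$ for $a>0$. $\phi^*(s)=\sup_{t\in\mathbb{R}}\{st-\phi(t)\}$ is the convex conjugate. Convention for $\eta=0$: $0\phi^*(s/0)=0$ if $s\le0$ and $+\infty$ if $s>0$. The infimum of the empty set is $+\infty$. *)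

theory Defs
  imports "HOL-Probability.Probability"
begin

definition ext_convex :: "(real \<Rightarrow> ennreal) \<Rightarrow> bool" where
  "ext_convex \<phi> \<longleftrightarrow> (\<forall>x y u. 0 \<le> u \<and> u \<le> 1 \<longrightarrow>
     \<phi> (u * x + (1 - u) * y) \<le> ennreal u * \<phi> x + ennreal (1 - u) * \<phi> y)"

definition lower_semicont :: "(real \<Rightarrow> ennreal) \<Rightarrow> bool" where
  "lower_semicont \<phi> \<longleftrightarrow> (\<forall>x. \<phi> x \<le> Liminf (at x) \<phi>)"

definition eff_dom :: "(real \<Rightarrow> ennreal) \<Rightarrow> real set" where
  "eff_dom \<phi> = {t. \<phi> t < \<infinity>}"

definition Phi0 :: "(real \<Rightarrow> ennreal) set" where
  "Phi0 = {\<phi>. ext_convex \<phi> \<and> \<phi> 1 = 0 \<and> eff_dom \<phi> \<subseteq> {0..} \<and> 1 \<in> interior (eff_dom \<phi>)}"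

text \<open>For convex lower-semicontinuous \<open>\<phi>\<close> with \<open>\<phi> 1 = 0\<close>, the convention that \<open>\<phi> 0\<close> is the limit
  of \<open>\<phi> t\<close> as \<open>t\<close> decreases to \<open>0\<close> holds automatically. The conventions for \<open>0 \<phi>(a/0)\<close> are never
  invoked, since the divergence is \<open>\<infinity>\<close> without absolute continuity.\<close>

definition divergence :: "(real \<Rightarrow> ennreal) \<Rightarrow> 'a measure \<Rightarrow> 'a measure \<Rightarrow> ennreal" where
  "divergence \<phi> Q P =
     (if absolutely_continuous P Q then \<integral>\<^sup>+ \<omega>. \<phi> (enn2real (RN_deriv P Q \<omega>)) \<partial>P else \<infinity>)"

definition scaled :: "real \<Rightarrow> (real \<Rightarrow> ennreal) \<Rightarrow> real \<Rightarrow> ennreal" where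
  "scaled l \<phi> t = ennreal l * \<phi> (t / l)"

text \<open>The argument is extended real because conjugates get composed and the inner one may be \<open>\<infinity>\<close>.
  If \<open>\<phi> 1 = 0\<close>, then the conjugate is \<open>\<infinity>\<close> at \<open>\<infinity>\<close> (take \<open>t = 1\<close>) and never \<open>- \<infinity>\<close> at a real point.\<close>

definition conjugate :: "(real \<Rightarrow> ennreal) \<Rightarrow> ereal \<Rightarrow> ereal" where
  "conjugate \<phi> s = (SUP t. s * ereal t - enn2ereal (\<phi> t))"

text \<open>The expression \<open>\<eta> \<phi>\<^sup>*(s/\<eta>)\<close>, including its convention for \<open>\<eta> = 0\<close>.\<close>

definition persp_conjugate :: "(real \<Rightarrow> ennreal) \<Rightarrow> real \<Rightarrow> ereal \<Rightarrow> ereal" where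
  "persp_conjugate \<phi> \<eta> s =
     (if \<eta> = 0 then (if s \<le> 0 then 0 else \<infinity>) else ereal \<eta> * conjugate \<phi> (s / ereal \<eta>))"

text \<open>Subtraction with \<open>\<infinity> - \<infinity> = - \<infinity>\<close> (on \<^typ>\<open>ereal\<close> the library has \<open>\<infinity> - \<infinity> = \<infinity>\<close>), so that in a
  maximisation an undefined objective, or one with infinite penalty, does not contribute.\<close>

definition low_diff :: "ereal \<Rightarrow> ennreal \<Rightarrow> ereal" where
  "low_diff a b = (if b = \<infinity> then - \<infinity> else a - enn2ereal b)"

text \<open>Integral of an extended-real function as positive minus negative part. For \<open>\<phi> 1 = 0\<close> one has
  \<open>\<eta> \<phi>\<^sup>*(s/\<eta>) \<ge> s\<close> if \<open>\<eta> > 0\<close> and \<open>\<ge> 0\<close> if \<open>\<eta> = 0\<close>, hence for integrable \<open>X\<close> the integrands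
  \<open>\<eta> \<phi>\<^sub>2\<^sup>*((\<phi>\<^sub>1\<^sup>*(-\<theta>\<^sub>2-X)+\<theta>\<^sub>1)/\<eta>)\<close> have an integrable negative part and \<open>\<infinity> - \<infinity>\<close> does not
  arise for them.\<close>

definition ext_integral :: "'a measure \<Rightarrow> ('a \<Rightarrow> ereal) \<Rightarrow> ereal" where
  "ext_integral M f =
     low_diff (enn2ereal (\<integral>\<^sup>+ \<omega>. e2ennreal (f \<omega>) \<partial>M)) (\<integral>\<^sup>+ \<omega>. e2ennreal (- f \<omega>) \<partial>M)"

definition prob_measures_on :: "'a measure \<Rightarrow> 'a measure set" where
  "prob_measures_on M = {Q. prob_space Q \<and> sets Q = sets M}"

definition robust_shortfall ::
  "'a measure \<Rightarrow> (real \<Rightarrow> ennreal) \<Rightarrow> (real \<Rightarrow> ennreal) \<Rightarrow> real \<Rightarrow> ('a \<Rightarrow> real) \<Rightarrow> ereal" where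
  "robust_shortfall P0 \<phi>1 \<phi>2 r X =
     (SUP l \<in> {0<..}.
      SUP Q \<in> {Q \<in> prob_measures_on P0. divergence \<phi>2 Q P0 \<le> ennreal r}.
      SUP Q' \<in> {Q' \<in> prob_measures_on P0. absolutely_continuous Q Q'}.
        low_diff (ext_integral Q' (\<lambda>\<omega>. ereal (- X \<omega>))) (divergence (scaled l \<phi>1) Q' Q))"

end

theory Submission
  imports Defs
begin

text \<open>
  Write \<open>g = dQ/dP\<^sub>0\<close> and \<open>dQ'/dQ = \<lambda> k\<close>. Since \<open>\<lambda>\<close> is then the normalising constant \<open>1 / E[g k]\<close>, the
  risk is at most \<open>\<theta>\<close> iff \<open>E[g ((- \<theta> - X) k - \<phi>\<^sub>1(k))] \<le> 0\<close> for all admissible \<open>g\<close> and all \<open>k\<close>, that is,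
  iff \<open>E[g W] \<le> 0\<close> for all admissible \<open>g\<close>, where \<open>W = \<phi>\<^sub>1\<^sup>*(- \<theta> - X)\<close>. The remaining problem in \<open>g\<close> has the
  two constraints \<open>E[g] = 1\<close> and \<open>E[\<phi>\<^sub>2(g)] \<le> r\<close>, and \<open>g = 1\<close> is a Slater point, so that multipliers
  \<open>\<theta>\<^sub>1\<close> and \<open>\<eta> \<ge> 0\<close> exist; interchanging supremum and expectation turns the Lagrangian into
  \<open>E[\<eta> \<phi>\<^sub>2\<^sup>*((W + \<theta>\<^sub>1)/\<eta>)] - \<theta>\<^sub>1 + \<eta> r\<close>. For \<open>\<eta> = 0\<close> the dual function differs from the stated convention
  if the domain of \<open>\<phi>\<^sub>2\<close> is not \<open>[0, \<infinity>)\<close>; that case is repaired by raising \<open>\<theta>\<close> slightly, which does not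
  affect the infimum.
\<close>

section \<open>Conjugates as countable suprema\<close>

text \<open>The two inequalities use different families of measures. The upper bound has to cope
  with arbitrary \<open>Q\<close> and \<open>Q'\<close>, so it is pointwise: Fenchel-Young
  inequalities are integrated, and the work lies in proving integrability. For the converse it is
  enough to test with densities that are simple functions with values in the interior of the
  effective domain. They are strictly positive and their products with integrable functions are
  integrable, so the separation argument takes place among finite numbers. Nothing is lost: a
  conjugate is already the supremum of affine functions indexed by the rational interior points,
  finite maxima over this countable family are attained by simple selections, and countability also
  makes the conjugates measurable. The obstacle at \<open>\<eta> = 0\<close> shows for a domain such
  as \<open>[1/2, 2]\<close>: its support function is finite at positive arguments, where the stated
  convention gives \<open>\<infinity>\<close>, so the multipliers found at \<open>\<theta>\<close>
  may be infeasible there.\<close>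

definition rat_dom :: "(real \<Rightarrow> ennreal) \<Rightarrow> real set" where
  "rat_dom \<phi> = \<rat> \<inter> interior (eff_dom \<phi>)"

text \<open>For \<open>\<eta> > 0\<close> this is \<open>\<eta> \<phi>\<^sup>*(s/\<eta>)\<close>; at \<open>\<eta> = 0\<close> it is the support function of the effective
  domain, which need not agree with the convention used in \<^const>\<open>persp_conjugate\<close>.\<close>

definition persp_sup :: "(real \<Rightarrow> ennreal) \<Rightarrow> real \<Rightarrow> real \<Rightarrow> ereal" where
  "persp_sup \<phi> \<eta> s = (SUP t \<in> rat_dom \<phi>. ereal (s * t - \<eta> * enn2real (\<phi> t)))"

section \<open>Convexity, effective domain and measurability of divergence functions\<close>

lemma enn2ereal_finite: "x < \<infinity> \<Longrightarrow> enn2ereal x = ereal (enn2real x)"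
  by (cases x) auto

lemma ennreal_not_finite: "\<not> x < \<infinity> \<Longrightarrow> x = (top :: ennreal)"
  by (cases x) auto

lemma Phi0_convexD:
  assumes "\<phi> \<in> Phi0" "0 \<le> u" "u \<le> 1"
  shows "\<phi> (u * x + (1 - u) * y) \<le> ennreal u * \<phi> x + ennreal (1 - u) * \<phi> y"
  using assms by (auto simp: Phi0_def ext_convex_def)

text \<open>Quasiconvexity is the form of convexity that stays convenient with infinite values: it
  makes sublevel sets and the effective domain intervals.\<close>

lemma Phi0_segment:
  assumes "\<phi> \<in> Phi0" and "min x y \<le> z" and "z \<le> max x y"
  shows "\<phi> z \<le> max (\<phi> x) (\<phi> y)"
proof (cases "x = y")
  case False
  define u where "u = (z - y) / (x - y)"
  have u: "0 \<le> u" "u \<le> 1"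
    using False assms by (auto simp: u_def divide_simps min_def max_def split: if_splits)
  have z: "z = u * x + (1 - u) * y"
  proof -
    have "u * (x - y) = z - y" using False by (simp add: u_def)
    then show ?thesis by (simp add: algebra_simps)
  qed
  have "\<phi> z \<le> ennreal u * \<phi> x + ennreal (1 - u) * \<phi> y"
    unfolding z by (rule Phi0_convexD[OF assms(1) u])
  also have "\<dots> \<le> ennreal u * max (\<phi> x) (\<phi> y) + ennreal (1 - u) * max (\<phi> x) (\<phi> y)"
    by (intro add_mono mult_left_mono) auto
  also have "\<dots> = ennreal (u + (1 - u)) * max (\<phi> x) (\<phi> y)"
    using u by (subst ennreal_plus) (auto simp: distrib_right)
  finally show ?thesis by simp
qed (use assms in \<open>auto simp: antisym\<close>)

lemma Phi0_one: "\<phi> \<in> Phi0 \<Longrightarrow> \<phi> 1 = 0"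
  by (simp add: Phi0_def)

lemma borel_measurable_Phi0:
  assumes "\<phi> \<in> Phi0"
  shows "\<phi> \<in> borel_measurable borel"
proof (rule borel_measurableI_le)
  fix y
  have "is_interval {x. \<phi> x \<le> y}"
    unfolding is_interval_1
  proof (intro ballI allI impI)
    fix a b x assume "a \<in> {x. \<phi> x \<le> y}" "b \<in> {x. \<phi> x \<le> y}" "a \<le> x \<and> x \<le> b"
    then show "x \<in> {x. \<phi> x \<le> y}"
      using Phi0_segment[OF assms, of a b x] by (auto simp: max_def split: if_splits)
  qed
  then show "{x \<in> space borel. \<phi> x \<le> y} \<in> sets borel"
    using real_interval_borel_measurable by simp
qed

text \<open>Passing to the interior discards the endpoint 0, which later keeps the test densities
  strictly positive.\<close>

lemma interior_eff_domD:
  assumes "\<phi> \<in> Phi0" "t \<in> interior (eff_dom \<phi>)"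
  shows "0 < t" "\<phi> t < \<infinity>"
proof -
  have "interior (eff_dom \<phi>) \<subseteq> interior {0..}"
    using assms(1) by (intro interior_mono) (auto simp: Phi0_def)
  then show "0 < t" using assms(2) by auto
  show "\<phi> t < \<infinity>"
    using assms(2) interior_subset[of "eff_dom \<phi>"] by (auto simp: eff_dom_def)
qed

lemma one_interior_eff_dom: "\<phi> \<in> Phi0 \<Longrightarrow> 1 \<in> interior (eff_dom \<phi>)"
  by (simp add: Phi0_def)

lemma one_rat_dom: "\<phi> \<in> Phi0 \<Longrightarrow> 1 \<in> rat_dom \<phi>"
  by (simp add: rat_dom_def one_interior_eff_dom)

lemma countable_rat_dom: "countable (rat_dom \<phi>)"
  unfolding rat_dom_def by (intro countable_Int1 countable_rat)

lemma range_from_nat_into_rat_dom: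
  "\<phi> \<in> Phi0 \<Longrightarrow> range (from_nat_into (rat_dom \<phi>)) = rat_dom \<phi>"
  using one_rat_dom countable_rat_dom by (intro range_from_nat_into) auto

lemma persp_sup_eq_SUP_nat:
  assumes "\<phi> \<in> Phi0"
  shows "persp_sup \<phi> \<eta> s = (SUP i. ereal (s * from_nat_into (rat_dom \<phi>) i
      - \<eta> * enn2real (\<phi> (from_nat_into (rat_dom \<phi>) i))))"
  unfolding persp_sup_def
  by (subst range_from_nat_into_rat_dom[OF assms, symmetric]) (simp add: image_image)

lemma rat_dom_pos: "\<phi> \<in> Phi0 \<Longrightarrow> t \<in> rat_dom \<phi> \<Longrightarrow> 0 < t"
  by (auto simp: rat_dom_def interior_eff_domD)

text \<open>Moving towards the minimiser \<open>1\<close> keeps a point in the interior of the domain and does not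
  increase \<open>\<phi>\<close>, so rational interior points suffice in the supremum.\<close>

lemma rat_dom_approx:
  assumes \<phi>: "\<phi> \<in> Phi0" and fin: "\<phi> t < \<infinity>" and "0 < e"
  obtains q where "q \<in> rat_dom \<phi>" "\<phi> q \<le> \<phi> t" "\<bar>q - t\<bar> < e"
proof -
  consider "t = 1" | "t < 1" | "1 < t" by linarith
  then show ?thesis
  proof cases
    case 1 then show ?thesis using that[of 1] one_rat_dom[OF \<phi>] \<open>0 < e\<close> by auto
  next
    case 2
    obtain q where q: "q \<in> \<rat>" "t < q" "q < min 1 (t + e)"
      using Rats_dense_in_real[of t "min 1 (t + e)"] 2 \<open>0 < e\<close> by auto
    have le: "\<phi> z \<le> \<phi> t" if "t < z" "z < 1" for z
      using Phi0_segment[OF \<phi>, of t 1 z] that Phi0_one[OF \<phi>] by (auto simp: max_def)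
    have "{t<..<1} \<subseteq> eff_dom \<phi>"
      using le_less_trans[OF le fin] by (auto simp: eff_dom_def)
    then have "q \<in> interior (eff_dom \<phi>)"
      using q by (intro interiorI[of "{t<..<1}"]) auto
    then show ?thesis using that[of q] q le[of q] by (auto simp: rat_dom_def)
  next
    case 3
    obtain q where q: "q \<in> \<rat>" "q < t" "max 1 (t - e) < q"
      using Rats_dense_in_real[of "max 1 (t - e)" t] 3 \<open>0 < e\<close> by auto
    have le: "\<phi> z \<le> \<phi> t" if "1 < z" "z < t" for z
      using Phi0_segment[OF \<phi>, of 1 t z] that Phi0_one[OF \<phi>] by (auto simp: max_def)
    have "{1<..<t} \<subseteq> eff_dom \<phi>"
      using le_less_trans[OF le fin] by (auto simp: eff_dom_def)
    then have "q \<in> interior (eff_dom \<phi>)"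
      using q by (intro interiorI[of "{1<..<t}"]) auto
    then show ?thesis using that[of q] q le[of q] by (auto simp: rat_dom_def)
  qed
qed

text \<open>This is Fenchel-Young at every point of finiteness, endpoints of the domain included:
  rational interior points near \<open>t\<close> do not increase \<open>\<phi>\<close>, and the
  linear term changes by at most \<open>e\<close>.\<close>

lemma persp_sup_upper:
  assumes \<phi>: "\<phi> \<in> Phi0" and "0 \<le> \<eta>" and fin: "\<phi> t < \<infinity>"
  shows "ereal (s * t - \<eta> * enn2real (\<phi> t)) \<le> persp_sup \<phi> \<eta> s"
proof (rule ereal_le_epsilon2)
  fix e :: real assume "0 < e"
  define d where "d = e / (\<bar>s\<bar> + 1)"
  have "0 < d" using \<open>0 < e\<close> by (simp add: d_def add_nonneg_pos)
  then obtain q where q: "q \<in> rat_dom \<phi>" "\<phi> q \<le> \<phi> t" "\<bar>q - t\<bar> < d"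
    using rat_dom_approx[OF \<phi> fin] by blast
  have "\<eta> * enn2real (\<phi> q) \<le> \<eta> * enn2real (\<phi> t)"
    using q(2) fin \<open>0 \<le> \<eta>\<close> by (intro mult_left_mono enn2real_mono) auto
  moreover have "s * t - s * q \<le> e"
  proof -
    have "s * t - s * q \<le> \<bar>s\<bar> * \<bar>q - t\<bar>"
      by (metis abs_ge_self abs_minus_commute abs_mult right_diff_distrib)
    also have "\<dots> \<le> (\<bar>s\<bar> + 1) * d" using q(3) by (intro mult_mono) auto
    finally show ?thesis by (simp add: d_def)
  qed
  ultimately have "ereal (s * t - \<eta> * enn2real (\<phi> t)) \<le> ereal (s * q - \<eta> * enn2real (\<phi> q)) + ereal e"
    by simp
  also have "\<dots> \<le> persp_sup \<phi> \<eta> s + ereal e"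
    unfolding persp_sup_def by (intro add_right_mono SUP_upper q)
  finally show "ereal (s * t - \<eta> * enn2real (\<phi> t)) \<le> persp_sup \<phi> \<eta> s + ereal e" .
qed

lemma conjugate_real_eq_persp_sup:
  assumes \<phi>: "\<phi> \<in> Phi0"
  shows "conjugate \<phi> (ereal s) = persp_sup \<phi> 1 s"
  unfolding conjugate_def
proof (rule antisym)
  show "(SUP t. ereal s * ereal t - enn2ereal (\<phi> t)) \<le> persp_sup \<phi> 1 s"
  proof (rule SUP_least)
    fix t
    show "ereal s * ereal t - enn2ereal (\<phi> t) \<le> persp_sup \<phi> 1 s"
    proof (cases "\<phi> t < \<infinity>")
      case True
      then have "enn2ereal (\<phi> t) = ereal (enn2real (\<phi> t))"
        by (rule enn2ereal_finite)
      then show ?thesis using persp_sup_upper[OF \<phi> _ True, of 1 s] by simp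
    next
      case False
      then have "\<phi> t = top" by (rule ennreal_not_finite)
      then show ?thesis by simp
    qed
  qed
  show "persp_sup \<phi> 1 s \<le> (SUP t. ereal s * ereal t - enn2ereal (\<phi> t))"
    unfolding persp_sup_def
  proof (rule SUP_least)
    fix t assume "t \<in> rat_dom \<phi>"
    then have "enn2ereal (\<phi> t) = ereal (enn2real (\<phi> t))"
      using interior_eff_domD(2)[OF \<phi>] by (intro enn2ereal_finite) (auto simp: rat_dom_def)
    then have "ereal (s * t - 1 * enn2real (\<phi> t)) = ereal s * ereal t - enn2ereal (\<phi> t)"
      by simp
    also have "\<dots> \<le> (SUP t. ereal s * ereal t - enn2ereal (\<phi> t))"
      by (rule SUP_upper) simp
    finally show "ereal (s * t - 1 * enn2real (\<phi> t)) \<le> (SUP t. ereal s * ereal t - enn2ereal (\<phi> t))" .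
  qed
qed

lemma conjugate_PInf:
  assumes "\<phi> \<in> Phi0"
  shows "conjugate \<phi> \<infinity> = \<infinity>"
proof -
  have "\<infinity> * ereal 1 - enn2ereal (\<phi> 1) \<le> conjugate \<phi> \<infinity>"
    unfolding conjugate_def by (rule SUP_upper) simp
  then show ?thesis using assms by (simp add: Phi0_one zero_ennreal.rep_eq)
qed

lemma persp_conjugate_real_eq_persp_sup:
  assumes \<phi>: "\<phi> \<in> Phi0" and "0 < \<eta>"
  shows "persp_conjugate \<phi> \<eta> (ereal s) = persp_sup \<phi> \<eta> s"
proof -
  have "persp_conjugate \<phi> \<eta> (ereal s) = ereal \<eta> * persp_sup \<phi> 1 (s / \<eta>)"
    using assms by (simp add: persp_conjugate_def conjugate_real_eq_persp_sup)
  also have "\<dots> = (SUP t \<in> rat_dom \<phi>. ereal \<eta> * ereal (s / \<eta> * t - 1 * enn2real (\<phi> t)))"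
    unfolding persp_sup_def using one_rat_dom[OF \<phi>] \<open>0 < \<eta>\<close>
    by (subst Sup_ereal_mult_left') (auto simp: image_image)
  also have "\<dots> = persp_sup \<phi> \<eta> s"
    unfolding persp_sup_def using \<open>0 < \<eta>\<close> by (simp add: right_diff_distrib)
  finally show ?thesis .
qed

lemma persp_conjugate_PInf: "\<phi> \<in> Phi0 \<Longrightarrow> 0 \<le> \<eta> \<Longrightarrow> persp_conjugate \<phi> \<eta> \<infinity> = \<infinity>"
  by (auto simp: persp_conjugate_def conjugate_PInf)

section \<open>Monotonicity and flat pieces of the conjugate and the support function\<close>

text \<open>The point \<open>t = 1\<close>, where \<open>\<phi>\<close> vanishes, gives this affine
  minorant; together with integrability of \<open>X\<close> it supplies the integrable lower bounds
  below.\<close>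

lemma persp_sup_ge: "\<phi> \<in> Phi0 \<Longrightarrow> ereal s \<le> persp_sup \<phi> \<eta> s"
  unfolding persp_sup_def by (rule SUP_upper2[of 1]) (auto simp: one_rat_dom Phi0_one)

lemma persp_sup_mono: "\<phi> \<in> Phi0 \<Longrightarrow> s \<le> s' \<Longrightarrow> persp_sup \<phi> \<eta> s \<le> persp_sup \<phi> \<eta> s'"
  unfolding persp_sup_def
  by (intro SUP_mono) (auto intro!: bexI mult_right_mono dest: rat_dom_pos)

lemma persp_sup_antimono: "\<eta> \<le> \<eta>' \<Longrightarrow> persp_sup \<phi> \<eta>' s \<le> persp_sup \<phi> \<eta> s"
  unfolding persp_sup_def
  by (intro SUP_mono) (auto intro!: bexI mult_right_mono)

lemma borel_measurable_persp_sup[measurable]: "persp_sup \<phi> \<eta> \<in> borel_measurable borel"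
  unfolding persp_sup_def by (intro borel_measurable_SUP countable_rat_dom) measurable

lemma persp_sup_one_zero: "persp_sup \<phi> 1 0 \<le> 0"
  unfolding persp_sup_def by (rule SUP_least) auto

text \<open>A nondecreasing convex function with equal values at two points is minimal there: a
  smaller value to the left of \<open>s'\<close> would pull the value at \<open>s'\<close> below
  \<open>w\<close>.\<close>

lemma persp_sup_flat_min:
  assumes \<phi>: "\<phi> \<in> Phi0" and "s' < s" and eq: "persp_sup \<phi> \<eta> s' = ereal w" "persp_sup \<phi> \<eta> s = ereal w"
  shows "ereal w \<le> persp_sup \<phi> \<eta> u"
proof (cases "s' \<le> u")
  case True then show ?thesis using persp_sup_mono[OF \<phi> True, of \<eta>] eq by simp
next
  case False
  then have "u < s'" by simp
  have "persp_sup \<phi> \<eta> u \<le> ereal w" using persp_sup_mono[OF \<phi>, of u s' \<eta>] False eq by simp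
  moreover have "ereal u \<le> persp_sup \<phi> \<eta> u" by (rule persp_sup_ge[OF \<phi>])
  ultimately obtain v where v: "persp_sup \<phi> \<eta> u = ereal v" by (cases "persp_sup \<phi> \<eta> u") auto
  define c where "c = (s - s') / (s - u)"
  have c: "0 < c" "c < 1" using \<open>s' < s\<close> \<open>u < s'\<close> by (auto simp: c_def)
  have s': "s' = c * u + (1 - c) * s"
  proof -
    have "s - u \<noteq> 0" using \<open>s' < s\<close> \<open>u < s'\<close> by simp
    then have "c * (s - u) = s - s'" by (simp add: c_def)
    then show ?thesis by (simp add: algebra_simps)
  qed
  \<comment> \<open>Convexity in \<open>s\<close> is checked term by term, since each term of the
    supremum is affine in \<open>s\<close>.\<close>
  have "persp_sup \<phi> \<eta> s' \<le> ereal (c * v + (1 - c) * w)"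
    unfolding persp_sup_def
  proof (rule SUP_least)
    fix t assume t: "t \<in> rat_dom \<phi>"
    let ?p = "\<eta> * enn2real (\<phi> t)"
    have "ereal (u * t - ?p) \<le> ereal v" "ereal (s * t - ?p) \<le> ereal w"
      unfolding v[symmetric] eq(2)[symmetric] persp_sup_def using t by (auto intro!: SUP_upper)
    then have "c * (u * t - ?p) + (1 - c) * (s * t - ?p) \<le> c * v + (1 - c) * w"
      using c by (intro add_mono mult_left_mono) auto
    then show "ereal (s' * t - ?p) \<le> ereal (c * v + (1 - c) * w)"
      unfolding s' by (simp add: algebra_simps)
  qed
  then have "c * w \<le> c * v" using eq by (simp add: algebra_simps)
  then show ?thesis using c v by simp
qed

text \<open>If the domain reaches down to 0, the terms \<open>s * t\<close> with small
  \<open>t\<close> come arbitrarily close to 0.\<close>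

lemma persp_sup_zero_nonneg:
  assumes \<phi>: "\<phi> \<in> Phi0" and small: "\<And>a. 0 < a \<Longrightarrow> \<exists>t \<in> rat_dom \<phi>. t < a"
  shows "0 \<le> persp_sup \<phi> 0 s"
proof (rule ereal_le_epsilon2)
  fix e :: real assume "0 < e"
  obtain t where t: "t \<in> rat_dom \<phi>" "t < e / (\<bar>s\<bar> + 1)"
    using small[of "e / (\<bar>s\<bar> + 1)"] \<open>0 < e\<close> by (auto simp: add_nonneg_pos)
  have "0 < t" using rat_dom_pos[OF \<phi> t(1)] .
  have "\<bar>s * t\<bar> \<le> (\<bar>s\<bar> + 1) * t" using \<open>0 < t\<close> by (simp add: abs_mult)
  also have "\<dots> \<le> e" using t(2) by (simp add: field_simps add_nonneg_pos less_imp_le)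
  finally have "0 \<le> ereal (s * t - 0 * enn2real (\<phi> t)) + ereal e" by simp
  also have "\<dots> \<le> persp_sup \<phi> 0 s + ereal e"
    unfolding persp_sup_def by (intro add_right_mono SUP_upper t)
  finally show "0 \<le> persp_sup \<phi> 0 s + ereal e" .
qed

text \<open>All slopes \<open>t\<close> are at least \<open>a > 0\<close>, so the support function
  increases at rate at least \<open>a\<close> where it is finite.\<close>

lemma persp_sup_zero_inj_lower_bound:
  assumes \<phi>: "\<phi> \<in> Phi0" and "0 < a" and a: "\<And>t. t \<in> rat_dom \<phi> \<Longrightarrow> a \<le> t"
    and "s' \<le> s" and eq: "persp_sup \<phi> 0 s' = ereal w" "persp_sup \<phi> 0 s = ereal w"
  shows "s' = s"
proof -
  have "persp_sup \<phi> 0 s' \<le> ereal (w - a * (s - s'))"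
    unfolding persp_sup_def
  proof (rule SUP_least)
    fix t assume t: "t \<in> rat_dom \<phi>"
    have "ereal (s * t - 0 * enn2real (\<phi> t)) \<le> ereal w"
      unfolding eq(2)[symmetric] persp_sup_def using t by (intro SUP_upper)
    moreover have "a * (s - s') \<le> t * (s - s')" using a[OF t] \<open>s' \<le> s\<close> by (intro mult_right_mono) auto
    ultimately show "ereal (s' * t - 0 * enn2real (\<phi> t)) \<le> ereal (w - a * (s - s'))"
      by (simp add: algebra_simps)
  qed
  then have "a * (s - s') \<le> 0" using eq by simp
  then show ?thesis using \<open>0 < a\<close> \<open>s' \<le> s\<close> by (simp add: mult_le_0_iff)
qed

text \<open>With slopes close to 0 injectivity can fail at nonpositive arguments. At a positive
  \<open>s\<close> the value is positive because of \<open>t = 1\<close>, and positive homogeneity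
  makes it drop strictly to the left.\<close>

lemma persp_sup_zero_inj_pos:
  assumes \<phi>: "\<phi> \<in> Phi0" and "0 < s" and "s' \<le> s"
    and eq: "persp_sup \<phi> 0 s' = ereal w" "persp_sup \<phi> 0 s = ereal w"
  shows "s' = s"
proof (rule ccontr)
  assume "s' \<noteq> s"
  then have "s' < s" using \<open>s' \<le> s\<close> by simp
  have "0 < w" using persp_sup_ge[OF \<phi>, of s 0] eq \<open>0 < s\<close> by simp
  \<comment> \<open>Truncating the ratio at 0 keeps \<open>c\<close> a legitimate factor for
    inequalities when \<open>s'\<close> is negative.\<close>
  define c where "c = max 0 (s' / s)"
  have c: "0 \<le> c" "c < 1" "s' \<le> c * s"
    using \<open>0 < s\<close> \<open>s' < s\<close> by (auto simp: c_def max_def field_simps)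
  have "persp_sup \<phi> 0 s' \<le> ereal (c * w)"
    unfolding persp_sup_def
  proof (rule SUP_least)
    fix t assume t: "t \<in> rat_dom \<phi>"
    have "ereal (s * t - 0 * enn2real (\<phi> t)) \<le> ereal w"
      unfolding eq(2)[symmetric] persp_sup_def using t by (intro SUP_upper)
    then have "c * (s * t) \<le> c * w" using c by (intro mult_left_mono) auto
    moreover have "s' * t \<le> c * s * t"
      using c rat_dom_pos[OF \<phi> t] by (intro mult_right_mono) auto
    ultimately show "ereal (s' * t - 0 * enn2real (\<phi> t)) \<le> ereal (c * w)"
      by (simp add: algebra_simps)
  qed
  then show False using eq c \<open>0 < w\<close> by simp
qed

section \<open>Interchange of supremum and integral\<close>

text \<open>The recursive form turns measurability into an induction, and the bound by
  \<open>n\<close> makes the selector finitely valued.\<close>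

primrec argmax_upto :: "(nat \<Rightarrow> 'a \<Rightarrow> real) \<Rightarrow> nat \<Rightarrow> 'a \<Rightarrow> nat" where
  "argmax_upto f 0 \<omega> = 0"
| "argmax_upto f (Suc n) \<omega> =
     (if f (argmax_upto f n \<omega>) \<omega> < f (Suc n) \<omega> then Suc n else argmax_upto f n \<omega>)"

lemma argmax_upto_le: "argmax_upto f n \<omega> \<le> n"
  by (induction n) auto

lemma argmax_upto_ge: "i \<le> n \<Longrightarrow> f i \<omega> \<le> f (argmax_upto f n \<omega>) \<omega>"
  by (induction n) (auto simp: le_Suc_eq intro: order_trans less_imp_le)

lemma measurable_argmax_upto:
  assumes [measurable]: "\<And>i. f i \<in> borel_measurable M"
  shows "argmax_upto f n \<in> measurable M (count_space UNIV)"
proof (induction n)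
  case (Suc n)
  note Suc[measurable]
  have [measurable]: "(\<lambda>\<omega>. f (argmax_upto f n \<omega>) \<omega>) \<in> borel_measurable M"
    by (rule measurable_compose_countable) measurable
  show ?case by simp
qed simp

lemma integrable_selection:
  fixes f :: "nat \<Rightarrow> 'a \<Rightarrow> real"
  assumes int: "\<And>i. integrable M (f i)" and N: "N \<in> measurable M (count_space UNIV)"
    and le: "\<And>\<omega>. N \<omega> \<le> n"
  shows "integrable M (\<lambda>\<omega>. f (N \<omega>) \<omega>)"
proof (rule Bochner_Integration.integrable_bound)
  show "integrable M (\<lambda>\<omega>. \<Sum>i\<le>n. \<bar>f i \<omega>\<bar>)"
    using int by (intro Bochner_Integration.integrable_sum integrable_abs)
  show "(\<lambda>\<omega>. f (N \<omega>) \<omega>) \<in> borel_measurable M"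
    by (rule measurable_compose_countable[OF borel_measurable_integrable[OF int] N])
  show "AE \<omega> in M. norm (f (N \<omega>) \<omega>) \<le> norm (\<Sum>i\<le>n. \<bar>f i \<omega>\<bar>)"
  proof (rule AE_I2)
    fix \<omega>
    have "\<bar>f (N \<omega>) \<omega>\<bar> \<le> (\<Sum>i\<le>n. \<bar>f i \<omega>\<bar>)"
      using le by (intro member_le_sum[of _ _ "\<lambda>i. \<bar>f i \<omega>\<bar>"]) auto
    then show "norm (f (N \<omega>) \<omega>) \<le> norm (\<Sum>i\<le>n. \<bar>f i \<omega>\<bar>)" by simp
  qed
qed

text \<open>Suprema and integrals interchange because every finite maximum is attained by a measurable
  selector.\<close>

lemma integral_SUP_selection:
  fixes f :: "nat \<Rightarrow> 'a \<Rightarrow> real"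
  assumes int: "\<And>i. integrable M (f i)"
    and sel: "\<And>n N. N \<in> measurable M (count_space UNIV) \<Longrightarrow> (\<And>\<omega>. N \<omega> \<le> n) \<Longrightarrow>
      (\<integral>\<omega>. f (N \<omega>) \<omega> \<partial>M) \<le> C"
  obtains h where "integrable M h" "AE \<omega> in M. (SUP i. ereal (f i \<omega>)) = ereal (h \<omega>)"
    "(\<integral>\<omega>. h \<omega> \<partial>M) \<le> C"
proof -
  have [measurable]: "f i \<in> borel_measurable M" for i using int by auto
  define m where "m n \<omega> = f (argmax_upto f n \<omega>) \<omega>" for n \<omega>
  have m: "integrable M (m n)" "(\<integral>\<omega>. m n \<omega> \<partial>M) \<le> C" for n
    unfolding m_def using measurable_argmax_upto[of f M n] argmax_upto_le[of f n]
    by (auto intro!: integrable_selection[OF int, of _ n] sel[of _ n])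
  have [measurable]: "m n \<in> borel_measurable M" for n using m by auto
  have m_ge: "i \<le> n \<Longrightarrow> f i \<omega> \<le> m n \<omega>" for i n \<omega>
    unfolding m_def by (rule argmax_upto_ge)
  \<comment> \<open>Subtracting \<open>f 0\<close> makes the increasing maxima nonnegative, so that
    monotone convergence applies; the supremum is recovered as \<open>f 0 + E\<close>.\<close>
  define E where "E \<omega> = (SUP n. ennreal (m n \<omega> - f 0 \<omega>))" for \<omega>
  have [measurable]: "E \<in> borel_measurable M" unfolding E_def by measurable
  have "incseq (\<lambda>n \<omega>. ennreal (m n \<omega> - f 0 \<omega>))"
    by (rule incseq_SucI) (auto simp: le_fun_def m_def intro!: ennreal_leI)
  then have "(\<integral>\<^sup>+\<omega>. E \<omega> \<partial>M) = (SUP n. \<integral>\<^sup>+\<omega>. ennreal (m n \<omega> - f 0 \<omega>) \<partial>M)"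
    unfolding E_def by (rule nn_integral_monotone_convergence_SUP) measurable
  also have "\<dots> = (SUP n. ennreal (\<integral>\<omega>. m n \<omega> - f 0 \<omega> \<partial>M))"
    by (intro SUP_cong refl nn_integral_eq_integral Bochner_Integration.integrable_diff m int)
      (auto simp: m_ge)
  also have "\<dots> \<le> ennreal (C - (\<integral>\<omega>. f 0 \<omega> \<partial>M))"
    using m int by (intro SUP_least ennreal_leI) (simp add: Bochner_Integration.integral_diff)
  finally have E_le: "(\<integral>\<^sup>+\<omega>. E \<omega> \<partial>M) \<le> ennreal (C - (\<integral>\<omega>. f 0 \<omega> \<partial>M))" .
  \<comment> \<open>Since \<open>ennreal\<close> truncates negative numbers to 0, the bound on
    \<open>E\<close> yields a real inequality only once the right-hand side is known to be
    nonnegative.\<close>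
  have C: "0 \<le> C - (\<integral>\<omega>. f 0 \<omega> \<partial>M)"
    using m(2)[of 0] by (simp add: m_def)
  have "(\<integral>\<^sup>+\<omega>. E \<omega> \<partial>M) \<noteq> \<infinity>"
    using E_le by (auto simp: top_unique)
  then have fin: "AE \<omega> in M. E \<omega> \<noteq> \<infinity>"
    by (intro nn_integral_noteq_infinite) auto
  then have E_real: "AE \<omega> in M. ennreal (enn2real (E \<omega>)) = E \<omega>"
    by eventually_elim (simp add: less_top)
  have nn: "(\<integral>\<^sup>+\<omega>. ennreal (enn2real (E \<omega>)) \<partial>M) = (\<integral>\<^sup>+\<omega>. E \<omega> \<partial>M)"
    using E_real by (rule nn_integral_cong_AE)
  have intE: "integrable M (\<lambda>\<omega>. enn2real (E \<omega>))"
    using E_le by (intro integrableI_nonneg) (auto simp: nn less_top[symmetric] top_unique)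
  have intE_le: "(\<integral>\<omega>. enn2real (E \<omega>) \<partial>M) \<le> C - (\<integral>\<omega>. f 0 \<omega> \<partial>M)"
    using E_le C unfolding nn[symmetric] nn_integral_eq_integral[OF intE AE_I2[OF enn2real_nonneg]]
    by simp
  show thesis
  proof (rule that[of "\<lambda>\<omega>. f 0 \<omega> + enn2real (E \<omega>)"])
    show "integrable M (\<lambda>\<omega>. f 0 \<omega> + enn2real (E \<omega>))" using int intE by simp
    show "(\<integral>\<omega>. f 0 \<omega> + enn2real (E \<omega>) \<partial>M) \<le> C" using int intE intE_le by simp
    show "AE \<omega> in M. (SUP i. ereal (f i \<omega>)) = ereal (f 0 \<omega> + enn2real (E \<omega>))"
      using E_real
    proof eventually_elim
      case (elim \<omega>)
      let ?s = "SUP i. ereal (f i \<omega>)"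
      have up: "ereal (f i \<omega>) \<le> ereal (f 0 \<omega> + enn2real (E \<omega>))" for i
      proof -
        have "ennreal (m i \<omega> - f 0 \<omega>) \<le> E \<omega>" unfolding E_def by (rule SUP_upper) simp
        also have "E \<omega> = ennreal (enn2real (E \<omega>))" using elim by simp
        finally have "m i \<omega> - f 0 \<omega> \<le> enn2real (E \<omega>)" by (simp add: ennreal_le_iff)
        then show ?thesis using m_ge[of i i \<omega>] by simp
      qed
      then have le: "?s \<le> ereal (f 0 \<omega> + enn2real (E \<omega>))" by (intro SUP_least)
      have f_le: "ereal (f i \<omega>) \<le> ?s" for i by (rule SUP_upper) simp
      obtain B where B: "?s = ereal B"
        using le f_le[of 0] by (cases ?s) auto
      have fB: "f i \<omega> \<le> B" for i using f_le[of i] B by simp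
      have "E \<omega> \<le> ennreal (B - f 0 \<omega>)"
        unfolding E_def using fB by (intro SUP_least ennreal_leI) (simp add: m_def)
      then have "ennreal (enn2real (E \<omega>)) \<le> ennreal (B - f 0 \<omega>)" using elim by simp
      then have "enn2real (E \<omega>) \<le> B - f 0 \<omega>" using fB[of 0] by (simp add: ennreal_le_iff)
      then show ?case using le B by (intro antisym) auto
    qed
  qed
qed

section \<open>Extended-real integrals\<close>

lemma ext_integral_eq_integral:
  assumes int: "integrable M h" and eq: "AE \<omega> in M. F \<omega> = ereal (h \<omega>)"
  shows "ext_integral M F = ereal (\<integral>\<omega>. h \<omega> \<partial>M)"
proof -
  have "(\<integral>\<^sup>+\<omega>. e2ennreal (F \<omega>) \<partial>M) = (\<integral>\<^sup>+\<omega>. ennreal (h \<omega>) \<partial>M)"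
    "(\<integral>\<^sup>+\<omega>. e2ennreal (- F \<omega>) \<partial>M) = (\<integral>\<^sup>+\<omega>. ennreal (- h \<omega>) \<partial>M)"
    using eq by (auto intro!: nn_integral_cong_AE)
  moreover have "(\<integral>\<^sup>+\<omega>. ennreal (h \<omega>) \<partial>M) < \<infinity>" "(\<integral>\<^sup>+\<omega>. ennreal (- h \<omega>) \<partial>M) < \<infinity>"
    using int by (auto simp: real_integrable_def less_top)
  ultimately show ?thesis
    unfolding ext_integral_def low_diff_def real_lebesgue_integral_def[OF int]
    by (simp add: enn2ereal_finite)
qed

text \<open>The minorant makes the negative part finite; a finite bound on the difference then
  forces the positive part to be finite as well.\<close>

lemma ext_integral_leD:
  assumes [measurable]: "F \<in> borel_measurable M" and b: "integrable M b"
    and ge: "AE \<omega> in M. ereal (b \<omega>) \<le> F \<omega>" and le: "ext_integral M F \<le> ereal c"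
  obtains f where "integrable M f" "AE \<omega> in M. F \<omega> = ereal (f \<omega>)" "(\<integral>\<omega>. f \<omega> \<partial>M) \<le> c"
proof -
  have "(\<integral>\<^sup>+\<omega>. e2ennreal (- F \<omega>) \<partial>M) \<le> (\<integral>\<^sup>+\<omega>. ennreal (- b \<omega>) \<partial>M)"
    using ge by (intro nn_integral_mono_AE) (auto simp flip: e2ennreal_ereal uminus_ereal.simps
      elim!: eventually_mono intro!: e2ennreal_mono simp: ereal_minus_le_minus)
  also have "\<dots> < \<infinity>" using b by (auto simp: real_integrable_def less_top)
  finally have neg: "(\<integral>\<^sup>+\<omega>. e2ennreal (- F \<omega>) \<partial>M) < \<infinity>" .
  have pos: "(\<integral>\<^sup>+\<omega>. e2ennreal (F \<omega>) \<partial>M) < \<infinity>"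
  proof (rule ccontr)
    assume "\<not> ?thesis"
    then have "(\<integral>\<^sup>+\<omega>. e2ennreal (F \<omega>) \<partial>M) = top" by (rule ennreal_not_finite)
    then show False
      using le neg enn2ereal_finite[OF neg]
      by (simp add: ext_integral_def low_diff_def less_top[symmetric])
  qed
  have "AE \<omega> in M. e2ennreal (F \<omega>) \<noteq> \<infinity>"
    using pos by (intro nn_integral_noteq_infinite) auto
  then have eq: "AE \<omega> in M. F \<omega> = ereal (real_of_ereal (F \<omega>))"
    using ge
  proof eventually_elim
    case (elim \<omega>)
    then show ?case by (cases "F \<omega>") auto
  qed
  have "(\<integral>\<^sup>+\<omega>. ennreal (real_of_ereal (F \<omega>)) \<partial>M) = (\<integral>\<^sup>+\<omega>. e2ennreal (F \<omega>) \<partial>M)"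
    "(\<integral>\<^sup>+\<omega>. ennreal (- real_of_ereal (F \<omega>)) \<partial>M) = (\<integral>\<^sup>+\<omega>. e2ennreal (- F \<omega>) \<partial>M)"
    using eq by (auto intro!: nn_integral_cong_AE elim!: eventually_mono)
      (metis e2ennreal_ereal uminus_ereal.simps(1))+
  then have int: "integrable M (\<lambda>\<omega>. real_of_ereal (F \<omega>))"
    using pos neg by (auto simp: real_integrable_def)
  show thesis
    using that[OF int eq] le ext_integral_eq_integral[OF int eq] by simp
qed

text \<open>Positive and negative parts are transferred separately. The nonnegative density can be
  pulled out of each, also at infinite values of \<open>H\<close>, because
  \<open>\<infinity> * 0 = 0\<close> on both sides.\<close>

lemma ext_integral_distributed:
  assumes X: "distributed M \<nu> X (\<lambda>x. ennreal (f x))" and f: "\<And>x. 0 \<le> f x"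
    and H: "H \<in> borel_measurable \<nu>"
  shows "ext_integral \<nu> (\<lambda>x. H x * ereal (f x)) = ext_integral M (\<lambda>\<omega>. H (X \<omega>))"
proof -
  have eq: "e2ennreal (y * ereal (f x)) = ennreal (f x) * e2ennreal y" for x and y :: ereal
  proof (cases "0 \<le> y")
    case True
    then obtain z where y: "y = enn2ereal z" by (metis enn2ereal_e2ennreal)
    have "y * ereal (f x) = enn2ereal (z * ennreal (f x))"
      using f by (simp add: y times_ennreal.rep_eq)
    then show ?thesis by (simp add: y mult.commute)
  next
    case False
    then have "y * ereal (f x) \<le> 0" using f[of x] by (simp add: mult_nonpos_nonneg ereal_mult_le_0_iff)
    then show ?thesis using False by (simp add: e2ennreal_neg)
  qed
  have "(\<integral>\<^sup>+x. e2ennreal (H x * ereal (f x)) \<partial>\<nu>) = (\<integral>\<^sup>+\<omega>. e2ennreal (H (X \<omega>)) \<partial>M)"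
    unfolding eq using H by (intro distributed_nn_integral[OF X, of "\<lambda>x. e2ennreal (H x)"]) measurable
  moreover have "(\<integral>\<^sup>+x. e2ennreal (- (H x * ereal (f x))) \<partial>\<nu>) = (\<integral>\<^sup>+\<omega>. e2ennreal (- H (X \<omega>)) \<partial>M)"
    unfolding ereal_mult_minus_left[symmetric] eq using H
    by (intro distributed_nn_integral[OF X, of "\<lambda>x. e2ennreal (- H x)"]) measurable
  ultimately show ?thesis by (simp add: ext_integral_def)
qed

section \<open>Weak duality\<close>

text \<open>Countable suprema give measurability of the outer function at real arguments only; the
  value \<open>\<infinity>\<close> of the inner conjugate is split off.\<close>

lemma borel_measurable_risk_integrand:
  assumes \<phi>: "\<phi>1 \<in> Phi0" "\<phi>2 \<in> Phi0" and "0 \<le> \<eta>"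
  shows "(\<lambda>x. persp_conjugate \<phi>2 \<eta> (conjugate \<phi>1 (ereal (- \<theta>2 - x)) + ereal \<theta>1))
    \<in> borel_measurable borel"
proof -
  let ?W = "\<lambda>x. persp_sup \<phi>1 1 (- \<theta>2 - x)"
  let ?G = "\<lambda>s. if \<eta> = 0 then (if s \<le> 0 then 0 else \<infinity>) else persp_sup \<phi>2 \<eta> s"
  have eq: "persp_conjugate \<phi>2 \<eta> (conjugate \<phi>1 (ereal (- \<theta>2 - x)) + ereal \<theta>1) =
    (if ?W x = \<infinity> then \<infinity> else ?G (real_of_ereal (?W x) + \<theta>1))" for x
  proof -
    have "ereal (- \<theta>2 - x) \<le> ?W x" by (rule persp_sup_ge[OF \<phi>(1)])
    then consider "?W x = \<infinity>" | w where "?W x = ereal w" by (cases "?W x") auto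
    then show ?thesis
    proof cases
      case 1
      then show ?thesis using persp_conjugate_PInf[OF \<phi>(2) \<open>0 \<le> \<eta>\<close>]
        by (simp add: conjugate_real_eq_persp_sup[OF \<phi>(1)])
    next
      case 2
      then show ?thesis using persp_conjugate_real_eq_persp_sup[OF \<phi>(2), of \<eta>] \<open>0 \<le> \<eta>\<close>
        by (auto simp: conjugate_real_eq_persp_sup[OF \<phi>(1)] persp_conjugate_def[of _ 0])
    qed
  qed
  have [measurable]: "?G \<in> borel_measurable borel" by measurable
  show ?thesis unfolding eq by measurable
qed

text \<open>The junk branch of \<^const>\<open>ext_integral\<close> is not taken: this gives the integrable lower bound.\<close>

lemma risk_integrand_ge:
  assumes \<phi>: "\<phi>1 \<in> Phi0" "\<phi>2 \<in> Phi0" and "0 \<le> \<eta>"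
  shows "ereal (if \<eta> = 0 then 0 else - \<theta>2 - x + \<theta>1) \<le>
    persp_conjugate \<phi>2 \<eta> (conjugate \<phi>1 (ereal (- \<theta>2 - x)) + ereal \<theta>1)"
proof (cases "\<eta> = 0")
  case False
  have ge: "ereal (- \<theta>2 - x) \<le> conjugate \<phi>1 (ereal (- \<theta>2 - x))"
    unfolding conjugate_real_eq_persp_sup[OF \<phi>(1)] by (rule persp_sup_ge[OF \<phi>(1)])
  then consider "conjugate \<phi>1 (ereal (- \<theta>2 - x)) = \<infinity>"
    | w where "conjugate \<phi>1 (ereal (- \<theta>2 - x)) = ereal w"
    by (cases "conjugate \<phi>1 (ereal (- \<theta>2 - x))") auto
  then show ?thesis
  proof cases
    case 1
    then show ?thesis by (simp add: persp_conjugate_PInf[OF \<phi>(2) \<open>0 \<le> \<eta>\<close>])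
  next
    case 2
    have "ereal (- \<theta>2 - x + \<theta>1) \<le> ereal (w + \<theta>1)" using ge 2 by simp
    also have "\<dots> \<le> persp_sup \<phi>2 \<eta> (w + \<theta>1)" by (rule persp_sup_ge[OF \<phi>(2)])
    finally show ?thesis using False \<open>0 \<le> \<eta>\<close> 2 by (simp add: persp_conjugate_real_eq_persp_sup[OF \<phi>(2)])
  qed
qed (auto simp: persp_conjugate_def)

text \<open>Fenchel-Young for \<open>\<phi>1\<close> at \<open>k\<close>, multiplied by
  \<open>g\<close>, is combined with Fenchel-Young for \<open>\<phi>2\<close> at \<open>g\<close>.
  Finiteness of \<open>\<phi>1 k\<close> is asked for only where \<open>0 < g\<close>, because a
  density with respect to \<open>Q\<close> is controlled only there.\<close>

lemma Fenchel_Young_nested: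
  assumes \<phi>: "\<phi>1 \<in> Phi0" "\<phi>2 \<in> Phi0" and "0 \<le> \<eta>"
    and F: "persp_conjugate \<phi>2 \<eta> (conjugate \<phi>1 (ereal y) + ereal \<theta>1) = ereal f"
    and "0 \<le> g" "\<phi>2 g < \<infinity>" and k: "0 < g \<Longrightarrow> \<phi>1 k < \<infinity>"
  shows "g * (y * k + \<theta>1) \<le> f + \<eta> * enn2real (\<phi>2 g) + g * enn2real (\<phi>1 k)"
proof -
  have "ereal y \<le> persp_sup \<phi>1 1 y" by (rule persp_sup_ge[OF \<phi>(1)])
  moreover have "persp_sup \<phi>1 1 y \<noteq> \<infinity>"
    using F persp_conjugate_PInf[OF \<phi>(2) \<open>0 \<le> \<eta>\<close>] by (auto simp: conjugate_real_eq_persp_sup[OF \<phi>(1)])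
  ultimately obtain w where w: "persp_sup \<phi>1 1 y = ereal w" by (cases "persp_sup \<phi>1 1 y") auto
  have 1: "g * (y * k) \<le> g * w + g * enn2real (\<phi>1 k)"
  proof (cases "g = 0")
    case False
    then have "0 < g" using \<open>0 \<le> g\<close> by simp
    have "y * k \<le> w + enn2real (\<phi>1 k)"
      using persp_sup_upper[OF \<phi>(1) _ k[OF \<open>0 < g\<close>], of 1 y] w by simp
    then show ?thesis using \<open>0 \<le> g\<close> by (metis distrib_left mult_left_mono)
  qed simp
  have 2: "g * (w + \<theta>1) \<le> f + \<eta> * enn2real (\<phi>2 g)"
  proof (cases "\<eta> = 0")
    case True
    then have "w + \<theta>1 \<le> 0" "f = 0"
      using F w by (auto simp: persp_conjugate_def conjugate_real_eq_persp_sup[OF \<phi>(1)] split: if_splits)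
    then show ?thesis using \<open>0 \<le> g\<close> True by (simp add: mult_nonneg_nonpos)
  next
    case False
    then have "persp_sup \<phi>2 \<eta> (w + \<theta>1) = ereal f"
      using F w \<open>0 \<le> \<eta>\<close> by (simp add: persp_conjugate_real_eq_persp_sup[OF \<phi>(2)] conjugate_real_eq_persp_sup[OF \<phi>(1)])
    then show ?thesis
      using persp_sup_upper[OF \<phi>(2) \<open>0 \<le> \<eta>\<close> \<open>\<phi>2 g < \<infinity>\<close>, of "w + \<theta>1"] by (simp add: algebra_simps)
  qed
  show ?thesis using 1 2 by (simp add: algebra_simps)
qed

lemma density_real_RN_deriv:
  assumes "prob_space P" "prob_space Q" "absolutely_continuous P Q" "sets Q = sets P"
  shows "Q = density P (\<lambda>\<omega>. ennreal (enn2real (RN_deriv P Q \<omega>)))"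
proof -
  interpret P: prob_space P by fact
  interpret Q: prob_space Q by fact
  have "AE \<omega> in P. RN_deriv P Q \<omega> \<noteq> \<infinity>"
    by (rule P.RN_deriv_finite[OF Q.sigma_finite_measure_axioms assms(3,4)])
  then have "AE \<omega> in P. RN_deriv P Q \<omega> = ennreal (enn2real (RN_deriv P Q \<omega>))"
    by eventually_elim (simp add: less_top)
  then have "density P (RN_deriv P Q) = density P (\<lambda>\<omega>. ennreal (enn2real (RN_deriv P Q \<omega>)))"
    by (intro density_cong) auto
  then show ?thesis using P.density_RN_deriv[OF assms(3,4)] by simp
qed

text \<open>The nested inequality is taken at \<open>g = dQ/dP0\<close> and \<open>k = h / l\<close>
  with \<open>h = dQ'/dQ\<close>, multiplied by \<open>l\<close> and integrated: the two mass
  conditions turn the terms in \<open>\<theta>1\<close> and \<open>\<theta>2\<close> into constants,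
  and the divergence constraint contributes \<open>\<eta> * r\<close>.\<close>

lemma weak_duality:
  fixes X :: "'a \<Rightarrow> real"
  assumes P0: "prob_space P0" and X: "integrable P0 X"
    and \<phi>: "\<phi>1 \<in> Phi0" "\<phi>2 \<in> Phi0" and "0 \<le> r" and "0 \<le> \<eta>" and "0 < l"
    and feas: "ext_integral P0 (\<lambda>\<omega>.
      persp_conjugate \<phi>2 \<eta> (conjugate \<phi>1 (ereal (- \<theta>2 - X \<omega>)) + ereal \<theta>1)) \<le> ereal (\<theta>1 - \<eta> * r)"
    and Q: "prob_space Q" "sets Q = sets P0" "divergence \<phi>2 Q P0 \<le> ennreal r"
    and Q': "prob_space Q'" "sets Q' = sets P0" "absolutely_continuous Q Q'"
  shows "low_diff (ext_integral Q' (\<lambda>\<omega>. ereal (- X \<omega>))) (divergence (scaled l \<phi>1) Q' Q) \<le> ereal \<theta>2"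
proof -
  interpret P0: prob_space P0 by fact
  interpret Q: prob_space Q by fact
  interpret Q': prob_space Q' by fact
  have [measurable]: "X \<in> borel_measurable P0" using X by auto
  note [measurable] = borel_measurable_Phi0[OF \<phi>(1)] borel_measurable_Phi0[OF \<phi>(2)]
  have ac: "absolutely_continuous P0 Q"
    using Q(3) by (auto simp: divergence_def top_unique split: if_splits)
  have sets[simp]: "sets Q = sets P0" "sets Q' = sets P0" by fact+
  define g where "g \<omega> = enn2real (RN_deriv P0 Q \<omega>)" for \<omega>
  define h where "h \<omega> = enn2real (RN_deriv Q Q' \<omega>)" for \<omega>
  have [measurable]: "g \<in> borel_measurable P0" by (simp add: g_def[abs_def])
  have hQ: "h \<in> borel_measurable Q" by (simp add: h_def[abs_def])
  then have [measurable]: "h \<in> borel_measurable P0" by (simp cong: measurable_cong_sets)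
  have nn[simp]: "0 \<le> g \<omega>" "0 \<le> h \<omega>" for \<omega> by (auto simp: g_def h_def)
  have Q_eq: "Q = density P0 (\<lambda>\<omega>. ennreal (g \<omega>))"
    unfolding g_def by (rule density_real_RN_deriv[OF P0 Q(1) ac Q(2)])
  have Q'_eq: "Q' = density P0 (\<lambda>\<omega>. ennreal (g \<omega> * h \<omega>))"
  proof -
    have "Q' = density Q (\<lambda>\<omega>. ennreal (h \<omega>))"
      unfolding h_def by (rule density_real_RN_deriv) (use Q' Q in auto)
    also have "\<dots> = density P0 (\<lambda>\<omega>. ennreal (g \<omega>) * ennreal (h \<omega>))"
      by (subst Q_eq) (rule density_density_eq; measurable)
    finally show ?thesis by (simp add: ennreal_mult)
  qed
  define D where "D = divergence (scaled l \<phi>1) Q' Q"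
  show ?thesis
  \<comment> \<open>In either case the objective is \<open>- \<infinity>\<close>: an infinite
    penalty by \<open>low_diff\<close>, and an infinite negative part of \<open>- X\<close> by the
    same rule inside \<open>ext_integral\<close>.\<close>
  proof (cases "D = \<infinity> \<or> (\<integral>\<^sup>+\<omega>. ennreal (X \<omega>) \<partial>Q') = \<infinity>")
    case True
    then show ?thesis
      by (cases D) (auto simp: low_diff_def D_def[symmetric] ext_integral_def)
  next
    case False
    have D_eq: "D = (\<integral>\<^sup>+\<omega>. ennreal (g \<omega>) * (ennreal l * \<phi>1 (h \<omega> / l)) \<partial>P0)"
    proof -
      have "D = (\<integral>\<^sup>+\<omega>. ennreal l * \<phi>1 (h \<omega> / l) \<partial>Q)"
        using Q'(3) by (simp add: D_def divergence_def scaled_def h_def)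
      also have "\<dots> = (\<integral>\<^sup>+\<omega>. ennreal l * \<phi>1 (h \<omega> / l) \<partial>density P0 (\<lambda>\<omega>. ennreal (g \<omega>)))"
        by (subst Q_eq) (rule refl)
      also have "\<dots> = (\<integral>\<^sup>+\<omega>. ennreal (g \<omega>) * (ennreal l * \<phi>1 (h \<omega> / l)) \<partial>P0)"
        by (rule nn_integral_density) measurable
      finally show ?thesis .
    qed
    \<comment> \<open>\<open>A\<close> vanishes together with \<open>g\<close>, whatever
      \<open>\<phi>1 (h / l)\<close> is there, so finiteness of \<open>\<phi>1\<close> has to be
      shown on \<open>0 < g\<close> only.\<close>
    define A where "A \<omega> = g \<omega> * enn2real (\<phi>1 (h \<omega> / l))" for \<omega>
    have [measurable]: "A \<in> borel_measurable P0" unfolding A_def by measurable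
    have "AE \<omega> in P0. ennreal (g \<omega>) * (ennreal l * \<phi>1 (h \<omega> / l)) \<noteq> \<infinity>"
      using False by (intro nn_integral_noteq_infinite) (auto simp: D_eq[symmetric])
    then have A_fin: "AE \<omega> in P0. 0 < g \<omega> \<longrightarrow> \<phi>1 (h \<omega> / l) < \<infinity>"
      by eventually_elim (use \<open>0 < l\<close> in \<open>auto simp: ennreal_mult_eq_top_iff less_top ennreal_eq_0_iff\<close>)
    have A_nn: "ennreal l * (\<integral>\<^sup>+\<omega>. ennreal (A \<omega>) \<partial>P0) = D"
    proof -
      have "ennreal l * (\<integral>\<^sup>+\<omega>. ennreal (A \<omega>) \<partial>P0) = (\<integral>\<^sup>+\<omega>. ennreal l * ennreal (A \<omega>) \<partial>P0)"
        unfolding A_def by (rule nn_integral_cmult[symmetric]) measurable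
      also have "\<dots> = D"
        unfolding D_eq
      proof (rule nn_integral_cong_AE)
        show "AE \<omega> in P0. ennreal l * ennreal (A \<omega>) = ennreal (g \<omega>) * (ennreal l * \<phi>1 (h \<omega> / l))"
          using A_fin
        proof eventually_elim
          case (elim \<omega>)
          show ?case
          proof (cases "g \<omega> = 0")
            case False
            then have "0 < g \<omega>" using nn(1)[of \<omega>] by linarith
            then have "ennreal (enn2real (\<phi>1 (h \<omega> / l))) = \<phi>1 (h \<omega> / l)" using elim by simp
            then show ?thesis by (simp add: A_def ennreal_mult ac_simps)
          qed (simp add: A_def)
        qed
      qed
      finally show ?thesis .
    qed
    have A_int: "integrable P0 A"
      using False A_nn \<open>0 < l\<close>
      by (intro integrableI_nonneg)
        (auto simp: A_def less_top[symmetric] ennreal_mult_eq_top_iff ennreal_eq_0_iff)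
    have A_eq: "enn2ereal D = ereal (l * (\<integral>\<omega>. A \<omega> \<partial>P0))"
      unfolding A_nn[symmetric] using \<open>0 < l\<close>
      by (subst nn_integral_eq_integral[OF A_int])
        (auto simp: A_def ennreal_mult[symmetric] integral_nonneg_AE)
    define B where "B \<omega> = enn2real (\<phi>2 (g \<omega>))" for \<omega>
    have [measurable]: "B \<in> borel_measurable P0" unfolding B_def by measurable
    have [simp]: "0 \<le> B \<omega>" for \<omega> by (simp add: B_def)
    have B_le: "(\<integral>\<^sup>+\<omega>. \<phi>2 (g \<omega>) \<partial>P0) \<le> ennreal r"
      using Q(3) ac by (simp add: divergence_def g_def)
    then have "AE \<omega> in P0. \<phi>2 (g \<omega>) \<noteq> \<infinity>"
      by (intro nn_integral_noteq_infinite) (auto simp: top_unique)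
    then have B_fin: "AE \<omega> in P0. \<phi>2 (g \<omega>) < \<infinity>"
      by eventually_elim (simp add: less_top)
    have B_nn: "(\<integral>\<^sup>+\<omega>. ennreal (B \<omega>) \<partial>P0) = (\<integral>\<^sup>+\<omega>. \<phi>2 (g \<omega>) \<partial>P0)"
      using B_fin by (intro nn_integral_cong_AE) (auto simp: B_def elim!: eventually_mono)
    have B_int: "integrable P0 B"
      using B_le unfolding B_nn[symmetric]
      by (intro integrableI_nonneg) (auto simp: B_def less_top[symmetric] top_unique)
    have B_integral: "(\<integral>\<omega>. B \<omega> \<partial>P0) \<le> r"
      using B_le \<open>0 \<le> r\<close> unfolding B_nn[symmetric]
      by (subst (asm) nn_integral_eq_integral[OF B_int]) simp_all
    obtain f where f: "integrable P0 f" "(\<integral>\<omega>. f \<omega> \<partial>P0) \<le> \<theta>1 - \<eta> * r"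
      and F: "AE \<omega> in P0. persp_conjugate \<phi>2 \<eta> (conjugate \<phi>1 (ereal (- \<theta>2 - X \<omega>)) + ereal \<theta>1) = ereal (f \<omega>)"
    proof (rule ext_integral_leD[OF _ _ _ feas])
      show "(\<lambda>\<omega>. persp_conjugate \<phi>2 \<eta> (conjugate \<phi>1 (ereal (- \<theta>2 - X \<omega>)) + ereal \<theta>1)) \<in> borel_measurable P0"
        by (rule measurable_compose[OF _ borel_measurable_risk_integrand[OF \<phi> \<open>0 \<le> \<eta>\<close>]]) measurable
      show "integrable P0 (\<lambda>\<omega>. if \<eta> = 0 then 0 else - \<theta>2 - X \<omega> + \<theta>1)"
        using X by (cases "\<eta> = 0") simp_all
    qed (use risk_integrand_ge[OF \<phi> \<open>0 \<le> \<eta>\<close>] in auto)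
    have g_int: "integrable P0 g" and g1: "(\<integral>\<omega>. g \<omega> \<partial>P0) = 1"
    proof -
      have "integrable Q (\<lambda>_. 1 :: real)" by simp
      then show "integrable P0 g" by (subst (asm) Q_eq) (simp add: integrable_density)
      have "(\<integral>\<omega>. 1 \<partial>Q) = (1 :: real)" by (simp add: Q.prob_space)
      then show "(\<integral>\<omega>. g \<omega> \<partial>P0) = 1" by (subst (asm) Q_eq, subst (asm) integral_density) auto
    qed
    have gh_int: "integrable P0 (\<lambda>\<omega>. g \<omega> * h \<omega>)" and gh1: "(\<integral>\<omega>. g \<omega> * h \<omega> \<partial>P0) = 1"
    proof -
      have "integrable Q' (\<lambda>_. 1 :: real)" by simp
      then show "integrable P0 (\<lambda>\<omega>. g \<omega> * h \<omega>)" by (subst (asm) Q'_eq) (simp add: integrable_density)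
      have "(\<integral>\<omega>. 1 \<partial>Q') = (1 :: real)" by (simp add: Q'.prob_space)
      then show "(\<integral>\<omega>. g \<omega> * h \<omega> \<partial>P0) = 1" by (subst (asm) Q'_eq, subst (asm) integral_density) auto
    qed
    \<comment> \<open>This is the integrable majorant of \<open>- g * h * X\<close> obtained by
      solving \<open>l\<close> times the nested inequality for that term.\<close>
    define R where "R \<omega> = l * (f \<omega> + \<eta> * B \<omega> + A \<omega> - \<theta>1 * g \<omega>) + \<theta>2 * (g \<omega> * h \<omega>)" for \<omega>
    have R_int: "integrable P0 R"
      unfolding R_def using f A_int B_int g_int gh_int by simp
    have bound: "AE \<omega> in P0. g \<omega> * h \<omega> * - X \<omega> \<le> R \<omega>"
      using F B_fin A_fin
    proof eventually_elim
      case (elim \<omega>)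
      have "g \<omega> * ((- \<theta>2 - X \<omega>) * (h \<omega> / l) + \<theta>1) \<le> f \<omega> + \<eta> * B \<omega> + A \<omega>"
        unfolding A_def B_def using elim by (intro Fenchel_Young_nested[OF \<phi> \<open>0 \<le> \<eta>\<close>]) auto
      then have "l * (g \<omega> * ((- \<theta>2 - X \<omega>) * (h \<omega> / l) + \<theta>1)) \<le> l * (f \<omega> + \<eta> * B \<omega> + A \<omega>)"
        using \<open>0 < l\<close> by (intro mult_left_mono) auto
      moreover have "l * (g \<omega> * ((- \<theta>2 - X \<omega>) * (h \<omega> / l) + \<theta>1)) =
        g \<omega> * h \<omega> * - X \<omega> - \<theta>2 * (g \<omega> * h \<omega>) + l * (\<theta>1 * g \<omega>)"
        using \<open>0 < l\<close> by (simp add: field_simps)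
      ultimately show ?case by (simp add: R_def algebra_simps)
    qed
    have pos_int: "integrable P0 (\<lambda>\<omega>. g \<omega> * h \<omega> * max 0 (X \<omega>))"
    proof (rule integrableI_nonneg)
      have "(\<integral>\<^sup>+\<omega>. ennreal (X \<omega>) \<partial>Q') = (\<integral>\<^sup>+\<omega>. ennreal (g \<omega> * h \<omega>) * ennreal (X \<omega>) \<partial>P0)"
        by (subst Q'_eq) (rule nn_integral_density; measurable)
      also have "\<dots> = (\<integral>\<^sup>+\<omega>. ennreal (g \<omega> * h \<omega> * max 0 (X \<omega>)) \<partial>P0)"
        by (intro nn_integral_cong) (simp add: ennreal_mult[symmetric] max_def ennreal_neg)
      finally show "(\<integral>\<^sup>+\<omega>. ennreal (g \<omega> * h \<omega> * max 0 (X \<omega>)) \<partial>P0) < \<infinity>"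
        using False by (simp add: less_top[symmetric])
    qed auto
    \<comment> \<open>The integrand lies between minus its integrable negative part and
      \<open>R\<close>; this is how integrability of \<open>X\<close> under \<open>Q'\<close>
      emerges.\<close>
    have U_int: "integrable P0 (\<lambda>\<omega>. g \<omega> * h \<omega> * - X \<omega>)"
    proof (rule Bochner_Integration.integrable_bound)
      show "integrable P0 (\<lambda>\<omega>. \<bar>R \<omega>\<bar> + g \<omega> * h \<omega> * max 0 (X \<omega>))" using R_int pos_int by simp
      show "AE \<omega> in P0. norm (g \<omega> * h \<omega> * - X \<omega>) \<le> norm (\<bar>R \<omega>\<bar> + g \<omega> * h \<omega> * max 0 (X \<omega>))"
        using bound
      proof eventually_elim
        case (elim \<omega>)
        have "g \<omega> * h \<omega> * X \<omega> \<le> g \<omega> * h \<omega> * max 0 (X \<omega>)" by (intro mult_left_mono) auto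
        moreover have "0 \<le> g \<omega> * h \<omega> * max 0 (X \<omega>)" by simp
        ultimately show ?case using elim by (simp only: real_norm_def mult_minus_right)
      qed
    qed measurable
    have "ext_integral Q' (\<lambda>\<omega>. ereal (- X \<omega>)) = ereal (\<integral>\<omega>. - X \<omega> \<partial>Q')"
    proof (rule ext_integral_eq_integral)
      show "integrable Q' (\<lambda>\<omega>. - X \<omega>)"
        using U_int by (subst Q'_eq, subst integrable_density) (auto simp: ac_simps)
    qed simp
    moreover have "(\<integral>\<omega>. - X \<omega> \<partial>Q') = (\<integral>\<omega>. g \<omega> * h \<omega> * - X \<omega> \<partial>P0)"
      by (subst Q'_eq, subst integral_density) (auto simp: ac_simps)
    moreover have "(\<integral>\<omega>. g \<omega> * h \<omega> * - X \<omega> \<partial>P0) \<le> (\<integral>\<omega>. R \<omega> \<partial>P0)"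
      using U_int R_int bound by (rule integral_mono_AE)
    moreover have "(\<integral>\<omega>. R \<omega> \<partial>P0) \<le> l * (\<integral>\<omega>. A \<omega> \<partial>P0) + \<theta>2"
    proof -
      have "(\<integral>\<omega>. R \<omega> \<partial>P0) = l * ((\<integral>\<omega>. f \<omega> \<partial>P0) + \<eta> * (\<integral>\<omega>. B \<omega> \<partial>P0) + (\<integral>\<omega>. A \<omega> \<partial>P0) - \<theta>1) + \<theta>2"
        unfolding R_def using f(1) A_int B_int g_int gh_int by (simp add: g1 gh1)
      moreover have "\<eta> * (\<integral>\<omega>. B \<omega> \<partial>P0) \<le> \<eta> * r" using B_integral \<open>0 \<le> \<eta>\<close> by (rule mult_left_mono)
      then have "l * ((\<integral>\<omega>. f \<omega> \<partial>P0) + \<eta> * (\<integral>\<omega>. B \<omega> \<partial>P0) + (\<integral>\<omega>. A \<omega> \<partial>P0) - \<theta>1) \<le> l * (\<integral>\<omega>. A \<omega> \<partial>P0)"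
        using f(2) \<open>0 < l\<close> by (intro mult_left_mono) auto
      ultimately show ?thesis by simp
    qed
    ultimately show ?thesis
      using False by (simp add: low_diff_def D_def[symmetric] A_eq)
  qed
qed

section \<open>Lagrange multipliers\<close>

lemma (in prob_space) integrable_simple_mult:
  fixes g w :: "'a \<Rightarrow> real"
  assumes g: "simple_function M g" and w: "integrable M w"
  shows "integrable M (\<lambda>\<omega>. g \<omega> * w \<omega>)"
proof -
  have "finite (g ` space M)" using g by (rule simple_functionD)
  then have "finite ((\<lambda>\<omega>. \<bar>g \<omega>\<bar>) ` space M)"
    by (metis finite_imageI image_image)
  then obtain B where B: "\<And>\<omega>. \<omega> \<in> space M \<Longrightarrow> \<bar>g \<omega>\<bar> \<le> B"
    using bdd_above_finite unfolding bdd_above_def by (metis imageI)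
  have [measurable]: "g \<in> borel_measurable M" using g by (rule borel_measurable_simple_function)
  have [measurable]: "w \<in> borel_measurable M" using w by auto
  show ?thesis
  proof (rule Bochner_Integration.integrable_bound)
    show "integrable M (\<lambda>\<omega>. B * w \<omega>)" using w by simp
    show "AE \<omega> in M. norm (g \<omega> * w \<omega>) \<le> norm (B * w \<omega>)"
      using B by (intro AE_I2) (auto simp: abs_mult intro!: mult_right_mono order_trans[OF B])
  qed measurable
qed

lemma (in prob_space) integrable_simple_function:
  fixes g :: "'a \<Rightarrow> real"
  assumes "simple_function M g"
  shows "integrable M g"
  using integrable_simple_mult[OF assms, of "\<lambda>_. 1"] by simp

lemma convex_interior_eff_dom:
  assumes "\<phi> \<in> Phi0"
  shows "convex (interior (eff_dom \<phi>))"
proof (rule convex_interior)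
  have "x \<in> eff_dom \<phi>" if "a \<in> eff_dom \<phi>" "b \<in> eff_dom \<phi>" "a \<le> x" "x \<le> b" for a b x
    using Phi0_segment[OF assms, of a b x] that
    by (auto simp: eff_dom_def max_def split: if_splits intro: le_less_trans)
  then show "convex (eff_dom \<phi>)"
    unfolding is_interval_convex_1[symmetric] is_interval_1 by blast
qed

lemma convex_on_enn2real_Phi0:
  assumes \<phi>: "\<phi> \<in> Phi0"
  shows "convex_on (interior (eff_dom \<phi>)) (\<lambda>t. enn2real (\<phi> t))"
proof (rule convex_onI)
  fix u x y :: real
  assume u: "0 < u" "u < 1" and x: "x \<in> interior (eff_dom \<phi>)" and y: "y \<in> interior (eff_dom \<phi>)"
  have fin: "\<phi> x < \<infinity>" "\<phi> y < \<infinity>" using interior_eff_domD(2)[OF \<phi>] x y by auto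
  have "\<phi> (u * y + (1 - u) * x) \<le> ennreal u * \<phi> y + ennreal (1 - u) * \<phi> x"
    using u by (intro Phi0_convexD[OF \<phi>]) auto
  also have "\<dots> = ennreal (u * enn2real (\<phi> y) + (1 - u) * enn2real (\<phi> x))"
    using u fin by (cases "\<phi> x"; cases "\<phi> y") (auto simp: ennreal_plus ennreal_mult)
  finally have "enn2real (\<phi> (u * y + (1 - u) * x)) \<le> u * enn2real (\<phi> y) + (1 - u) * enn2real (\<phi> x)"
    using u by (intro enn2real_leI) auto
  then show "enn2real (\<phi> ((1 - u) *\<^sub>R x + u *\<^sub>R y)) \<le> (1 - u) * enn2real (\<phi> x) + u * enn2real (\<phi> y)"
    by (simp add: add.commute)
qed (rule convex_interior_eff_dom[OF \<phi>])

text \<open>Finitely many values guarantee that all expectations exist; values in the interior of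
  the domain keep \<open>\<phi>\<close> finite and the weights positive. Mass one is not built in,
  because that constraint receives a multiplier.\<close>

definition simple_weights :: "'a measure \<Rightarrow> (real \<Rightarrow> ennreal) \<Rightarrow> ('a \<Rightarrow> real) set" where
  "simple_weights M \<phi> = {g. simple_function M g \<and> (\<forall>\<omega>. g \<omega> \<in> interior (eff_dom \<phi>))}"

text \<open>Separate in \<open>\<real>\<^sup>3\<close> the attainable triples
  (mass defect, divergence excess, objective) from the forbidden ones. The constant weights \<open>1\<close> and
  \<open>1 \<plusminus> \<epsilon>\<close> are Slater points, which makes the multiplier of the objective nonzero.\<close>

lemma (in prob_space) Lagrange_multipliers:
  assumes \<phi>: "\<phi> \<in> Phi0" and "0 < r" and w: "integrable M w"
    and opt: "\<And>g. g \<in> simple_weights M \<phi> \<Longrightarrow> expectation g = 1 \<Longrightarrow>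
      expectation (\<lambda>\<omega>. enn2real (\<phi> (g \<omega>))) \<le> r \<Longrightarrow> expectation (\<lambda>\<omega>. g \<omega> * w \<omega>) \<le> 0"
  obtains \<eta> \<theta> where "0 \<le> \<eta>"
    "\<And>g. g \<in> simple_weights M \<phi> \<Longrightarrow>
      expectation (\<lambda>\<omega>. g \<omega> * (w \<omega> + \<theta>) - \<eta> * enn2real (\<phi> (g \<omega>))) \<le> \<theta> - \<eta> * r"
proof -
  define p where "p t = enn2real (\<phi> t)" for t
  define G where "G = simple_weights M \<phi>"
  have G: "simple_function M g" "\<And>\<omega>. g \<omega> \<in> interior (eff_dom \<phi>)" if "g \<in> G" for g
    using that by (auto simp: G_def simple_weights_def)
  have int_g: "integrable M g" if "g \<in> G" for g
    using G(1)[OF that] by (rule integrable_simple_function)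
  have int_p: "integrable M (\<lambda>\<omega>. p (g \<omega>))" if "g \<in> G" for g
    using simple_function_compose[OF G(1)[OF that], of p]
    by (intro integrable_simple_function) (simp add: comp_def)
  have int_w: "integrable M (\<lambda>\<omega>. g \<omega> * w \<omega>)" if "g \<in> G" for g
    by (rule integrable_simple_mult[OF G(1)[OF that] w])
  \<comment> \<open>The mass coordinate is affine in \<open>g\<close> and stays exact; divergence
    and objective are relaxed to inequalities, since convexity of \<open>\<phi>\<close> only bounds
    the divergence of a mixture from above.\<close>
  define S where "S = {(x, y, z). \<exists>g \<in> G. x = expectation g - 1 \<and>
    expectation (\<lambda>\<omega>. p (g \<omega>)) - r \<le> y \<and> z \<le> expectation (\<lambda>\<omega>. g \<omega> * w \<omega>)}"
  define T where "T = {(x :: real, y :: real, z :: real). x = 0 \<and> y \<le> 0 \<and> 0 < z}"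
  have const: "(\<lambda>_. c) \<in> G" if "c \<in> interior (eff_dom \<phi>)" for c
    using that by (simp add: G_def simple_weights_def)
  have "convex S"
  proof (rule convexI)
    fix a b :: "real \<times> real \<times> real" and u v :: real
    assume "a \<in> S" "b \<in> S" and uv: "0 \<le> u" "0 \<le> v" "u + v = 1"
    then obtain g h where g: "g \<in> G" "fst a = expectation g - 1"
        "expectation (\<lambda>\<omega>. p (g \<omega>)) - r \<le> fst (snd a)" "snd (snd a) \<le> expectation (\<lambda>\<omega>. g \<omega> * w \<omega>)"
      and h: "h \<in> G" "fst b = expectation h - 1"
        "expectation (\<lambda>\<omega>. p (h \<omega>)) - r \<le> fst (snd b)" "snd (snd b) \<le> expectation (\<lambda>\<omega>. h \<omega> * w \<omega>)"
      by (auto simp: S_def)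
    define k where "k \<omega> = u * g \<omega> + v * h \<omega>" for \<omega>
    have k: "k \<in> G"
      unfolding G_def simple_weights_def
    proof (intro CollectI conjI allI)
      show "simple_function M k"
        unfolding k_def using G(1)[OF g(1)] G(1)[OF h(1)] by auto
      show "k \<omega> \<in> interior (eff_dom \<phi>)" for \<omega>
        using convexD[OF convex_interior_eff_dom[OF \<phi>] G(2)[OF g(1), of \<omega>] G(2)[OF h(1), of \<omega>] uv]
        by (simp add: k_def)
    qed
    have v: "v = 1 - u" using uv by simp
    have 1: "expectation k - 1 = u * fst a + v * fst b"
      unfolding k_def g h using int_g[OF g(1)] int_g[OF h(1)] by (simp add: v algebra_simps)
    have "expectation (\<lambda>\<omega>. p (k \<omega>)) \<le> expectation (\<lambda>\<omega>. u * p (g \<omega>) + v * p (h \<omega>))"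
    proof (rule integral_mono)
      show "p (k \<omega>) \<le> u * p (g \<omega>) + v * p (h \<omega>)" for \<omega>
        using convex_onD[OF convex_on_enn2real_Phi0[OF \<phi>], of v "g \<omega>" "h \<omega>"]
          G(2)[OF g(1), of \<omega>] G(2)[OF h(1), of \<omega>] uv
        by (simp add: k_def p_def v)
    qed (use int_p k g h in auto)
    also have "\<dots> = u * expectation (\<lambda>\<omega>. p (g \<omega>)) + v * expectation (\<lambda>\<omega>. p (h \<omega>))"
      using int_p[OF g(1)] int_p[OF h(1)] by simp
    also have "\<dots> \<le> u * (fst (snd a) + r) + v * (fst (snd b) + r)"
      using g h uv by (intro add_mono mult_left_mono) auto
    finally have 2: "expectation (\<lambda>\<omega>. p (k \<omega>)) - r \<le> u * fst (snd a) + v * fst (snd b)"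
      by (simp add: v algebra_simps)
    have "u * snd (snd a) + v * snd (snd b) \<le>
      u * expectation (\<lambda>\<omega>. g \<omega> * w \<omega>) + v * expectation (\<lambda>\<omega>. h \<omega> * w \<omega>)"
      using g h uv by (intro add_mono mult_left_mono) auto
    also have "\<dots> = expectation (\<lambda>\<omega>. u * (g \<omega> * w \<omega>) + v * (h \<omega> * w \<omega>))"
      using int_w[OF g(1)] int_w[OF h(1)] by simp
    finally have 3: "u * snd (snd a) + v * snd (snd b) \<le> expectation (\<lambda>\<omega>. k \<omega> * w \<omega>)"
      by (simp add: k_def algebra_simps)
    show "u *\<^sub>R a + v *\<^sub>R b \<in> S"
      unfolding S_def using 1 2 3 k by (auto simp: case_prod_beta intro!: bexI[of _ k])
  qed
  moreover have "convex T"
    unfolding T_def convex_def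
    by (auto simp: mult_nonneg_nonpos intro!: add_nonpos_nonpos)
      (metis add.left_neutral add_nonneg_pos add_pos_nonneg less_eq_real_def mult_pos_pos mult_zero_left zero_less_one)
  moreover have "S \<noteq> {}" using const[OF one_interior_eff_dom[OF \<phi>]] by (auto simp: S_def)
  moreover have "(0, 0, 1) \<in> T" by (simp add: T_def)
  then have "T \<noteq> {}" by blast
  moreover have "S \<inter> T = {}"
    using opt by (force simp: S_def T_def G_def p_def)
  ultimately obtain a b where "a \<noteq> 0" and aS: "\<And>x. x \<in> S \<Longrightarrow> inner a x \<le> b"
    and aT: "\<And>x. x \<in> T \<Longrightarrow> b \<le> inner a x"
    using separating_hyperplane_sets[of S T] by blast
  obtain \<alpha> \<beta> \<gamma> where a: "a = (\<alpha>, \<beta>, \<gamma>)" by (cases a)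
  have T: "b \<le> \<beta> * y + \<gamma> * z" if "y \<le> 0" "0 < z" for y z
    using aT[of "(0, y, z)"] that by (simp add: T_def a)
  have "b \<le> 0"
  proof (rule field_le_epsilon)
    fix e :: real assume "0 < e"
    \<comment> \<open>The third coordinate is taken so close to 0 that \<open>\<gamma>\<close> times
      it is at most \<open>e\<close>.\<close>
    have "b \<le> \<gamma> * (e / (\<bar>\<gamma>\<bar> + 1))" using T[of 0 "e / (\<bar>\<gamma>\<bar> + 1)"] \<open>0 < e\<close> by (simp add: add_nonneg_pos)
    also have "\<dots> \<le> e" using \<open>0 < e\<close> by (simp add: field_simps add_nonneg_pos abs_if)
    finally show "b \<le> 0 + e" by simp
  qed
  have "\<beta> \<le> 0"
  proof (rule ccontr)
    assume "\<not> \<beta> \<le> 0"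
    \<comment> \<open>This \<open>y\<close> solves \<open>\<beta> * y + \<gamma> = b - 1\<close>,
      violating the bound on \<open>T\<close>; \<open>min 0 y\<close> keeps the point in
      \<open>T\<close>. The sign of \<open>\<gamma>\<close> is settled likewise, with
      \<open>max 1 z\<close>.\<close>
    define y where "y = (b - \<gamma> - 1) / \<beta>"
    have "b \<le> \<beta> * min 0 y + \<gamma> * 1" by (rule T) auto
    also have "\<dots> \<le> \<beta> * y + \<gamma>" using \<open>\<not> \<beta> \<le> 0\<close> by (simp add: min_def)
    also have "\<dots> = b - 1" using \<open>\<not> \<beta> \<le> 0\<close> by (simp add: y_def)
    finally show False by simp
  qed
  have "0 \<le> \<gamma>"
  proof (rule ccontr)
    assume "\<not> 0 \<le> \<gamma>"
    define z where "z = (b - 1) / \<gamma>"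
    have "b \<le> \<beta> * 0 + \<gamma> * max 1 z" by (rule T) auto
    also have "\<dots> \<le> \<gamma> * z" using \<open>\<not> 0 \<le> \<gamma>\<close> by (simp add: max_def)
    also have "\<dots> = b - 1" using \<open>\<not> 0 \<le> \<gamma>\<close> by (simp add: z_def)
    finally show False by simp
  qed
  have S: "\<alpha> * (expectation g - 1) + \<beta> * (expectation (\<lambda>\<omega>. p (g \<omega>)) - r)
    + \<gamma> * expectation (\<lambda>\<omega>. g \<omega> * w \<omega>) \<le> 0" if "g \<in> G" for g
  proof -
    have "inner a (expectation g - 1, expectation (\<lambda>\<omega>. p (g \<omega>)) - r, expectation (\<lambda>\<omega>. g \<omega> * w \<omega>)) \<le> b"
      using that by (intro aS) (auto simp: S_def)
    then show ?thesis using \<open>b \<le> 0\<close> by (simp add: a)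
  qed
  have "\<gamma> \<noteq> 0"
  proof
    assume "\<gamma> = 0"
    have "0 \<le> \<beta>"
      using S[OF const[OF one_interior_eff_dom[OF \<phi>]]] \<open>\<gamma> = 0\<close> \<open>0 < r\<close>
      by (simp add: p_def Phi0_one[OF \<phi>] prob_space mult_le_0_iff zero_le_mult_iff)
    then have "\<beta> = 0" using \<open>\<beta> \<le> 0\<close> by simp
    obtain e where e: "0 < e" "ball 1 e \<subseteq> interior (eff_dom \<phi>)"
      using one_interior_eff_dom[OF \<phi>] open_contains_ball[of "interior (eff_dom \<phi>)"] by auto
    have "1 + e / 2 \<in> interior (eff_dom \<phi>)" "1 - e / 2 \<in> interior (eff_dom \<phi>)"
      using e by (auto simp: dist_real_def subset_eq)
    from S[OF const[OF this(1)]] S[OF const[OF this(2)]] have "\<alpha> * e \<le> 0" "0 \<le> \<alpha> * e"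
      using \<open>\<gamma> = 0\<close> \<open>\<beta> = 0\<close> by (simp_all add: prob_space)
    then have "\<alpha> = 0" using \<open>0 < e\<close> by (simp add: mult_le_0_iff zero_le_mult_iff)
    then show False using \<open>\<gamma> = 0\<close> \<open>\<beta> = 0\<close> \<open>a \<noteq> 0\<close> by (simp add: a zero_prod_def)
  qed
  then have "0 < \<gamma>" using \<open>0 \<le> \<gamma>\<close> by simp
  show thesis
  \<comment> \<open>Dividing by \<open>\<gamma>\<close> normalises the multiplier of the objective
    to 1, and the sign change makes that of the divergence nonnegative.\<close>
  proof (rule that[of "- \<beta> / \<gamma>" "\<alpha> / \<gamma>"])
    show "0 \<le> - \<beta> / \<gamma>" using \<open>\<beta> \<le> 0\<close> \<open>0 < \<gamma>\<close> by (simp add: divide_nonpos_pos)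
    fix g assume "g \<in> simple_weights M \<phi>"
    then have g: "g \<in> G" by (simp add: G_def)
    have "expectation (\<lambda>\<omega>. g \<omega> * (w \<omega> + \<alpha> / \<gamma>) - - \<beta> / \<gamma> * p (g \<omega>)) =
      expectation (\<lambda>\<omega>. g \<omega> * w \<omega> + \<alpha> / \<gamma> * g \<omega> + \<beta> / \<gamma> * p (g \<omega>))"
      by (simp add: algebra_simps)
    also have "\<dots> = expectation (\<lambda>\<omega>. g \<omega> * w \<omega>) + \<alpha> / \<gamma> * expectation g + \<beta> / \<gamma> * expectation (\<lambda>\<omega>. p (g \<omega>))"
      using int_g[OF g] int_p[OF g] int_w[OF g] by simp
    also have "\<dots> \<le> \<alpha> / \<gamma> - - \<beta> / \<gamma> * r"
      using divide_nonpos_pos[OF S[OF g] \<open>0 < \<gamma>\<close>] \<open>0 < \<gamma>\<close>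
      by (simp add: add_divide_distrib diff_divide_distrib algebra_simps)
    finally show "expectation (\<lambda>\<omega>. g \<omega> * (w \<omega> + \<alpha> / \<gamma>) - - \<beta> / \<gamma> * enn2real (\<phi> (g \<omega>))) \<le> \<alpha> / \<gamma> - - \<beta> / \<gamma> * r"
      by (simp add: p_def)
  qed
qed

section \<open>Finite selections as test weights\<close>

lemma simple_function_bounded_selection:
  fixes N :: "'a \<Rightarrow> nat"
  assumes "N \<in> measurable M (count_space UNIV)" "\<And>\<omega>. N \<omega> \<le> n"
  shows "simple_function M N"
proof -
  have "N ` space M \<subseteq> {..n}" using assms(2) by auto
  then have "finite (N ` space M)" using finite_subset by blast
  then show ?thesis
    using assms(1) by (auto simp: simple_function_def intro: measurable_sets)
qed

lemma simple_weights_selection: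
  assumes \<phi>: "\<phi> \<in> Phi0" and N: "N \<in> measurable M (count_space UNIV)" "\<And>\<omega>. N \<omega> \<le> n"
  shows "(\<lambda>\<omega>. from_nat_into (rat_dom \<phi>) (N \<omega>)) \<in> simple_weights M \<phi>"
proof -
  have "from_nat_into (rat_dom \<phi>) i \<in> interior (eff_dom \<phi>)" for i
    using range_from_nat_into_rat_dom[OF \<phi>] unfolding rat_dom_def by blast
  then show ?thesis
    using simple_function_compose[OF simple_function_bounded_selection[OF N]]
    by (simp add: simple_weights_def comp_def)
qed

text \<open>Selecting among finitely many rational points produces a simple weight, so a bound valid
  for all simple weights passes to the pointwise supremum.\<close>

lemma (in prob_space) integral_persp_sup_le:
  assumes \<phi>: "\<phi> \<in> Phi0" and v: "integrable M v"
    and le: "\<And>g. g \<in> simple_weights M \<phi> \<Longrightarrow>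
      expectation (\<lambda>\<omega>. g \<omega> * v \<omega> - \<eta> * enn2real (\<phi> (g \<omega>))) \<le> C"
  obtains h where "integrable M h" "AE \<omega> in M. persp_sup \<phi> \<eta> (v \<omega>) = ereal (h \<omega>)" "expectation h \<le> C"
proof (rule integral_SUP_selection)
  let ?t = "from_nat_into (rat_dom \<phi>)"
  let ?f = "\<lambda>i \<omega>. v \<omega> * ?t i - \<eta> * enn2real (\<phi> (?t i))"
  show "integrable M (?f i)" for i using v by simp
  show "expectation (\<lambda>\<omega>. ?f (N \<omega>) \<omega>) \<le> C"
    if "N \<in> measurable M (count_space UNIV)" "\<And>\<omega>. N \<omega> \<le> n" for N n
    using le[OF simple_weights_selection[OF \<phi> that]] by (simp add: mult.commute)
  fix h assume "integrable M h" "AE \<omega> in M. (SUP i. ereal (?f i \<omega>)) = ereal (h \<omega>)" "expectation h \<le> C"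
  then show thesis by (intro that) (simp_all add: persp_sup_eq_SUP_nat[OF \<phi>])
qed

section \<open>From the risk bound to the conjugate\<close>

lemma divergence_density:
  fixes g :: "'a \<Rightarrow> real"
  assumes "prob_space P" and [measurable]: "g \<in> borel_measurable P" and nn: "\<And>\<omega>. 0 \<le> g \<omega>"
  shows "divergence \<phi> (density P (\<lambda>\<omega>. ennreal (g \<omega>))) P = (\<integral>\<^sup>+\<omega>. \<phi> (g \<omega>) \<partial>P)"
proof -
  interpret prob_space P by fact
  have "AE \<omega> in P. ennreal (g \<omega>) = RN_deriv P (density P (\<lambda>\<omega>. ennreal (g \<omega>))) \<omega>"
    by (rule RN_deriv_unique) auto
  then have "AE \<omega> in P. \<phi> (enn2real (RN_deriv P (density P (\<lambda>\<omega>. ennreal (g \<omega>))) \<omega>)) = \<phi> (g \<omega>)"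
  proof eventually_elim
    case (elim \<omega>)
    show ?case unfolding elim[symmetric] by (simp add: nn)
  qed
  from nn_integral_cong_AE[OF this] show ?thesis
    by (simp add: divergence_def absolutely_continuousI_density)
qed

lemma prob_space_real_density:
  fixes g :: "'a \<Rightarrow> real"
  assumes g: "integrable P g" and nn: "\<And>\<omega>. 0 \<le> g \<omega>" and 1: "(\<integral>\<omega>. g \<omega> \<partial>P) = 1"
  shows "prob_space (density P (\<lambda>\<omega>. ennreal (g \<omega>)))"
proof (rule prob_spaceI)
  have [measurable]: "g \<in> borel_measurable P" using g by auto
  have "emeasure (density P (\<lambda>\<omega>. ennreal (g \<omega>))) (space P) = (\<integral>\<^sup>+\<omega>. ennreal (g \<omega>) \<partial>P)"
    by (subst emeasure_density) (auto intro!: nn_integral_cong)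
  also have "\<dots> = 1" using nn_integral_eq_integral[OF g] nn 1 by simp
  finally show "emeasure (density P (\<lambda>\<omega>. ennreal (g \<omega>))) (space (density P (\<lambda>\<omega>. ennreal (g \<omega>)))) = 1"
    by simp
qed

lemma robust_shortfall_upper:
  assumes "0 < l" "Q \<in> prob_measures_on P0" "divergence \<phi>2 Q P0 \<le> ennreal r"
    "Q' \<in> prob_measures_on P0" "absolutely_continuous Q Q'"
  shows "low_diff (ext_integral Q' (\<lambda>\<omega>. ereal (- X \<omega>))) (divergence (scaled l \<phi>1) Q' Q)
    \<le> robust_shortfall P0 \<phi>1 \<phi>2 r X"
  unfolding robust_shortfall_def
  by (rule SUP_upper2[of l], use assms in simp, rule SUP_upper2[of Q], use assms in simp,
      rule SUP_upper2[of Q'], use assms in simp, rule order_refl)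

lemma simple_weightsD:
  assumes "g \<in> simple_weights M \<phi>" "\<phi> \<in> Phi0"
  shows "simple_function M g" "0 < g \<omega>" "\<phi> (g \<omega>) = ennreal (enn2real (\<phi> (g \<omega>)))"
  using assms interior_eff_domD[OF assms(2)] by (auto simp: simple_weights_def)

lemma simple_weights_one: "\<phi> \<in> Phi0 \<Longrightarrow> (\<lambda>_. 1) \<in> simple_weights M \<phi>"
  by (simp add: simple_weights_def one_interior_eff_dom)

text \<open>Here \<open>g\<close> is the density of \<open>Q\<close> and \<open>k\<close> an
  unnormalised density of \<open>Q'\<close> with respect to \<open>Q\<close>. The free scale in the
  risk measure absorbs the normalisation, which leaves an inequality without a mass constraint on
  \<open>k\<close>.\<close>

lemma robust_shortfall_le_imp:
  fixes X :: "'a \<Rightarrow> real"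
  assumes P0: "prob_space P0" and X: "integrable P0 X" and \<phi>: "\<phi>1 \<in> Phi0" "\<phi>2 \<in> Phi0"
    and \<rho>: "robust_shortfall P0 \<phi>1 \<phi>2 r X \<le> ereal \<theta>"
    and g: "g \<in> simple_weights P0 \<phi>2" "(\<integral>\<omega>. g \<omega> \<partial>P0) = 1" "(\<integral>\<omega>. enn2real (\<phi>2 (g \<omega>)) \<partial>P0) \<le> r"
    and k: "k \<in> simple_weights P0 \<phi>1"
  shows "(\<integral>\<omega>. g \<omega> * (k \<omega> * (- \<theta> - X \<omega>) - enn2real (\<phi>1 (k \<omega>))) \<partial>P0) \<le> 0"
proof -
  interpret prob_space P0 by fact
  have [measurable]: "X \<in> borel_measurable P0" using X by auto
  note gs = simple_weightsD[OF g(1) \<phi>(2)] and ks = simple_weightsD[OF k \<phi>(1)]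
  have [measurable]: "g \<in> borel_measurable P0" "k \<in> borel_measurable P0"
    using gs(1) ks(1) by (auto intro: borel_measurable_simple_function)
  note [measurable] = borel_measurable_Phi0[OF \<phi>(1)] borel_measurable_Phi0[OF \<phi>(2)]
  have nn[simp]: "0 \<le> g \<omega>" "0 \<le> k \<omega>" for \<omega> using gs(2)[of \<omega>] ks(2)[of \<omega>] by auto
  have gk: "simple_function P0 (\<lambda>\<omega>. g \<omega> * k \<omega>)" using gs(1) ks(1) by auto
  have gp: "simple_function P0 (\<lambda>\<omega>. g \<omega> * enn2real (\<phi>1 (k \<omega>)))"
    using gs(1) simple_function_compose[OF ks(1), of "\<lambda>t. enn2real (\<phi>1 t)"] by (auto simp: comp_def)
  note gk_int = integrable_simple_function[OF gk] and gp_int = integrable_simple_function[OF gp]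
  have gkX_int: "integrable P0 (\<lambda>\<omega>. g \<omega> * k \<omega> * X \<omega>)" by (rule integrable_simple_mult[OF gk X])
  define c where "c = expectation (\<lambda>\<omega>. g \<omega> * k \<omega>)"
  have "0 \<le> c" unfolding c_def by (intro integral_nonneg_AE) simp
  moreover have "c \<noteq> 0"
  proof
    assume "c = 0"
    then have "AE \<omega> in P0. g \<omega> * k \<omega> = 0"
      unfolding c_def using integral_nonneg_eq_0_iff_AE[OF gk_int] by simp
    moreover have "g \<omega> * k \<omega> \<noteq> 0" for \<omega> using gs(2)[of \<omega>] ks(2)[of \<omega>] by simp
    ultimately show False using AE_False by simp
  qed
  ultimately have "0 < c" by simp
  \<comment> \<open>With this scale \<open>l * k\<close> has mass one under \<open>Q\<close>, and
    \<open>scaled l \<phi>1 (l * k)\<close> reduces to \<open>l * \<phi>1 k\<close>.\<close>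
  define l where "l = 1 / c"
  have "0 < l" using \<open>0 < c\<close> by (simp add: l_def)
  define Q where "Q = density P0 (\<lambda>\<omega>. ennreal (g \<omega>))"
  define Q' where "Q' = density P0 (\<lambda>\<omega>. ennreal (l * (g \<omega> * k \<omega>)))"
  have Q: "prob_space Q"
    unfolding Q_def using integrable_simple_function[OF gs(1)] g(2) by (intro prob_space_real_density) auto
  have Q': "prob_space Q'"
    unfolding Q'_def using gk_int \<open>0 < c\<close> by (intro prob_space_real_density) (auto simp: l_def c_def[symmetric])
  have [simp]: "sets Q = sets P0" "sets Q' = sets P0" by (auto simp: Q_def Q'_def)
  have lk: "(\<lambda>\<omega>. l * k \<omega>) \<in> borel_measurable Q" by (simp add: Q_def)
  have Q'_eq: "Q' = density Q (\<lambda>\<omega>. ennreal (l * k \<omega>))"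
    unfolding Q_def Q'_def using \<open>0 < l\<close>
    by (subst density_density_eq) (auto intro!: density_cong simp: ennreal_mult[symmetric] ac_simps)
  have "(\<integral>\<^sup>+\<omega>. \<phi>2 (g \<omega>) \<partial>P0) = (\<integral>\<^sup>+\<omega>. ennreal (enn2real (\<phi>2 (g \<omega>))) \<partial>P0)"
    by (intro nn_integral_cong gs(3))
  also have "\<dots> = ennreal (expectation (\<lambda>\<omega>. enn2real (\<phi>2 (g \<omega>))))"
    using simple_function_compose[OF gs(1), of "\<lambda>t. enn2real (\<phi>2 t)"]
    by (intro nn_integral_eq_integral integrable_simple_function) (auto simp: comp_def)
  also have "\<dots> \<le> ennreal r" using g(3) by (rule ennreal_leI)
  finally have div2: "divergence \<phi>2 Q P0 \<le> ennreal r"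
    unfolding Q_def by (subst divergence_density[OF P0]) auto
  have "divergence (scaled l \<phi>1) Q' Q = (\<integral>\<^sup>+\<omega>. scaled l \<phi>1 (l * k \<omega>) \<partial>Q)"
    unfolding Q'_eq using \<open>0 < l\<close> by (intro divergence_density[OF Q lk]) auto
  also have "\<dots> = (\<integral>\<^sup>+\<omega>. ennreal l * \<phi>1 (k \<omega>) \<partial>Q)"
    using \<open>0 < l\<close> by (simp add: scaled_def)
  also have "\<dots> = (\<integral>\<^sup>+\<omega>. ennreal (g \<omega>) * (ennreal l * \<phi>1 (k \<omega>)) \<partial>P0)"
    unfolding Q_def by (rule nn_integral_density) measurable
  also have "\<dots> = (\<integral>\<^sup>+\<omega>. ennreal (l * (g \<omega> * enn2real (\<phi>1 (k \<omega>)))) \<partial>P0)"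
  proof (rule nn_integral_cong)
    fix \<omega>
    have "ennreal (g \<omega>) * (ennreal l * \<phi>1 (k \<omega>)) = ennreal (g \<omega>) * (ennreal l * ennreal (enn2real (\<phi>1 (k \<omega>))))"
      using ks(3)[of \<omega>] by metis
    then show "ennreal (g \<omega>) * (ennreal l * \<phi>1 (k \<omega>)) = ennreal (l * (g \<omega> * enn2real (\<phi>1 (k \<omega>))))"
      using \<open>0 < l\<close> by (simp add: ennreal_mult[symmetric] ac_simps)
  qed
  also have "\<dots> = ennreal (l * expectation (\<lambda>\<omega>. g \<omega> * enn2real (\<phi>1 (k \<omega>))))"
    using gp_int \<open>0 < l\<close> by (subst nn_integral_eq_integral) auto
  finally have div1: "divergence (scaled l \<phi>1) Q' Q = ennreal (l * expectation (\<lambda>\<omega>. g \<omega> * enn2real (\<phi>1 (k \<omega>))))" .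
  have X': "integrable Q' (\<lambda>\<omega>. - X \<omega>)"
    unfolding Q'_def using gkX_int \<open>0 < l\<close> by (subst integrable_density) (auto simp: ac_simps)
  have "ext_integral Q' (\<lambda>\<omega>. ereal (- X \<omega>)) = ereal (\<integral>\<omega>. - X \<omega> \<partial>Q')"
    using X' by (rule ext_integral_eq_integral) simp
  also have "(\<integral>\<omega>. - X \<omega> \<partial>Q') = (\<integral>\<omega>. - l * (g \<omega> * k \<omega> * X \<omega>) \<partial>P0)"
    unfolding Q'_def using \<open>0 < l\<close> by (subst integral_density) (auto simp: ac_simps)
  also have "\<dots> = - l * expectation (\<lambda>\<omega>. g \<omega> * k \<omega> * X \<omega>)" by (rule integral_mult_right_zero)
  finally have X_eq: "ext_integral Q' (\<lambda>\<omega>. ereal (- X \<omega>)) = ereal (- l * expectation (\<lambda>\<omega>. g \<omega> * k \<omega> * X \<omega>))" .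
  have "absolutely_continuous Q Q'"
    unfolding Q'_eq using lk by (intro absolutely_continuousI_density) simp
  then have "low_diff (ext_integral Q' (\<lambda>\<omega>. ereal (- X \<omega>))) (divergence (scaled l \<phi>1) Q' Q) \<le> ereal \<theta>"
    using Q Q' div2 \<open>0 < l\<close>
    by (intro order_trans[OF robust_shortfall_upper \<rho>]) (auto simp: prob_measures_on_def)
  then have "- l * expectation (\<lambda>\<omega>. g \<omega> * k \<omega> * X \<omega>) - l * expectation (\<lambda>\<omega>. g \<omega> * enn2real (\<phi>1 (k \<omega>))) \<le> \<theta>"
    unfolding X_eq div1 low_diff_def using \<open>0 < l\<close> by (simp add: integral_nonneg_AE)
  then have "- expectation (\<lambda>\<omega>. g \<omega> * k \<omega> * X \<omega>) - expectation (\<lambda>\<omega>. g \<omega> * enn2real (\<phi>1 (k \<omega>))) \<le> \<theta> * c"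
    using \<open>0 < c\<close> by (simp add: l_def field_simps)
  moreover have "expectation (\<lambda>\<omega>. g \<omega> * (k \<omega> * (- \<theta> - X \<omega>) - enn2real (\<phi>1 (k \<omega>)))) =
    expectation (\<lambda>\<omega>. (- \<theta> * (g \<omega> * k \<omega>) - g \<omega> * k \<omega> * X \<omega>) - g \<omega> * enn2real (\<phi>1 (k \<omega>)))"
    by (simp add: algebra_simps)
  moreover have "\<dots> = - \<theta> * c - expectation (\<lambda>\<omega>. g \<omega> * k \<omega> * X \<omega>) - expectation (\<lambda>\<omega>. g \<omega> * enn2real (\<phi>1 (k \<omega>)))"
    unfolding c_def using gk_int gkX_int gp_int by simp
  ultimately show ?thesis by simp
qed

text \<open>This is the maximisation over \<open>k\<close>. The weight \<open>g = 1\<close> alone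
  already yields integrability of the inner conjugate \<open>w\<close>; for other \<open>g\<close>
  the interchange is repeated with the affine terms multiplied by \<open>g\<close>.\<close>

lemma robust_shortfall_le_imp_conjugate:
  fixes X :: "'a \<Rightarrow> real"
  assumes P0: "prob_space P0" and X: "integrable P0 X" and \<phi>: "\<phi>1 \<in> Phi0" "\<phi>2 \<in> Phi0" and "0 \<le> r"
    and \<rho>: "robust_shortfall P0 \<phi>1 \<phi>2 r X \<le> ereal \<theta>"
  obtains w where "integrable P0 w" "AE \<omega> in P0. persp_sup \<phi>1 1 (- \<theta> - X \<omega>) = ereal (w \<omega>)"
    "\<And>g. g \<in> simple_weights P0 \<phi>2 \<Longrightarrow> (\<integral>\<omega>. g \<omega> \<partial>P0) = 1 \<Longrightarrow>
      (\<integral>\<omega>. enn2real (\<phi>2 (g \<omega>)) \<partial>P0) \<le> r \<Longrightarrow> (\<integral>\<omega>. g \<omega> * w \<omega> \<partial>P0) \<le> 0"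
proof -
  interpret prob_space P0 by fact
  note bound = robust_shortfall_le_imp[OF P0 X \<phi> \<rho>]
  have Y: "integrable P0 (\<lambda>\<omega>. - \<theta> - X \<omega>)" using X by simp
  obtain w where w: "integrable P0 w" "AE \<omega> in P0. persp_sup \<phi>1 1 (- \<theta> - X \<omega>) = ereal (w \<omega>)"
  proof (rule integral_persp_sup_le[OF \<phi>(1) Y])
    show "expectation (\<lambda>\<omega>. k \<omega> * (- \<theta> - X \<omega>) - 1 * enn2real (\<phi>1 (k \<omega>))) \<le> 0"
      if "k \<in> simple_weights P0 \<phi>1" for k
      using bound[OF simple_weights_one[OF \<phi>(2)] _ _ that] \<open>0 \<le> r\<close>
      by (simp add: Phi0_one[OF \<phi>(2)] prob_space)
  qed
  show thesis
  proof (rule that[OF w])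
    fix g assume g: "g \<in> simple_weights P0 \<phi>2" "expectation g = 1" "expectation (\<lambda>\<omega>. enn2real (\<phi>2 (g \<omega>))) \<le> r"
    note gs = simple_weightsD[OF g(1) \<phi>(2)]
    let ?t = "from_nat_into (rat_dom \<phi>1)"
    let ?f = "\<lambda>i \<omega>. (- \<theta> - X \<omega>) * ?t i - 1 * enn2real (\<phi>1 (?t i))"
    obtain h where h: "integrable P0 h" "AE \<omega> in P0. (SUP i. ereal (g \<omega> * ?f i \<omega>)) = ereal (h \<omega>)" "expectation h \<le> 0"
    proof (rule integral_SUP_selection)
      show "integrable P0 (\<lambda>\<omega>. g \<omega> * ?f i \<omega>)" for i
        using Y by (intro integrable_simple_mult gs(1)) simp
      show "expectation (\<lambda>\<omega>. g \<omega> * ?f (N \<omega>) \<omega>) \<le> 0"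
        if "N \<in> measurable P0 (count_space UNIV)" "\<And>\<omega>. N \<omega> \<le> n" for N n
        using bound[OF g simple_weights_selection[OF \<phi>(1) that]] by (simp add: mult.commute)
    qed
    have "AE \<omega> in P0. g \<omega> * w \<omega> = h \<omega>"
      using h(2) w(2)
    proof eventually_elim
      case (elim \<omega>)
      \<comment> \<open>Positivity of \<open>g\<close> allows pulling it out of the supremum, which
        identifies the limit as \<open>g * w\<close>.\<close>
      have "ereal (h \<omega>) = (SUP i. ereal (g \<omega>) * ereal (?f i \<omega>))" using elim(1) by simp
      also have "\<dots> = ereal (g \<omega>) * (SUP i. ereal (?f i \<omega>))"
        using gs(2)[of \<omega>] by (subst Sup_ereal_mult_left') (auto simp: image_image)
      also have "(SUP i. ereal (?f i \<omega>)) = ereal (w \<omega>)"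
        using elim(2) by (simp add: persp_sup_eq_SUP_nat[OF \<phi>(1)])
      finally show ?case by simp
    qed
    then have "expectation (\<lambda>\<omega>. g \<omega> * w \<omega>) = expectation h"
      using integrable_simple_mult[OF gs(1) w(1)] h(1) by (intro integral_cong_AE) auto
    then show "expectation (\<lambda>\<omega>. g \<omega> * w \<omega>) \<le> 0" using h(3) by simp
  qed
qed

section \<open>Strong duality\<close>

lemma ext_integral_risk_pos:
  assumes \<phi>: "\<phi>1 \<in> Phi0" "\<phi>2 \<in> Phi0" and "0 < \<eta>"
    and w: "AE \<omega> in P0. persp_sup \<phi>1 1 (- \<theta>2 - X \<omega>) = ereal (w \<omega>)"
    and h: "integrable P0 h" "AE \<omega> in P0. persp_sup \<phi>2 \<eta> (w \<omega> + \<theta>1) = ereal (h \<omega>)"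
  shows "ext_integral P0 (\<lambda>\<omega>.
    persp_conjugate \<phi>2 \<eta> (conjugate \<phi>1 (ereal (- \<theta>2 - X \<omega>)) + ereal \<theta>1)) = ereal (\<integral>\<omega>. h \<omega> \<partial>P0)"
proof (rule ext_integral_eq_integral[OF h(1)])
  show "AE \<omega> in P0. persp_conjugate \<phi>2 \<eta> (conjugate \<phi>1 (ereal (- \<theta>2 - X \<omega>)) + ereal \<theta>1) = ereal (h \<omega>)"
    using w h(2)
  proof eventually_elim
    case (elim \<omega>)
    then show ?case
      using persp_conjugate_real_eq_persp_sup[OF \<phi>(2) \<open>0 < \<eta>\<close>, of "w \<omega> + \<theta>1"]
      by (simp add: conjugate_real_eq_persp_sup[OF \<phi>(1)])
  qed
qed

lemma ext_integral_risk_zero: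
  assumes \<phi>: "\<phi>1 \<in> Phi0"
    and w: "AE \<omega> in P0. persp_sup \<phi>1 1 (- \<theta>2 - X \<omega>) = ereal (w \<omega>)" "AE \<omega> in P0. w \<omega> + \<theta>1 \<le> 0"
  shows "ext_integral P0 (\<lambda>\<omega>.
    persp_conjugate \<phi>2 0 (conjugate \<phi>1 (ereal (- \<theta>2 - X \<omega>)) + ereal \<theta>1)) = 0"
proof -
  have "AE \<omega> in P0. persp_conjugate \<phi>2 0 (conjugate \<phi>1 (ereal (- \<theta>2 - X \<omega>)) + ereal \<theta>1) = ereal 0"
    using w by eventually_elim (simp add: conjugate_real_eq_persp_sup[OF \<phi>] persp_conjugate_def)
  from ext_integral_eq_integral[OF _ this] show ?thesis by (simp add: zero_ereal_def)
qed

text \<open>A vanishing divergence multiplier is the delicate case: there the dual function involves the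
  support function \<^term>\<open>persp_sup \<phi>2 0\<close> instead of the convention in \<^const>\<open>persp_conjugate\<close>. Raising
  \<open>\<theta>\<close> to \<open>\<theta>'\<close> either gains room for a small positive multiplier, or leaves the integrand unchanged,
  and then \<open>w + \<theta>1 \<le> 0\<close> or \<open>w\<close> is the constant \<open>inf \<phi>1\<^sup>*\<close>.\<close>

lemma feasible_of_zero_multiplier:
  fixes X :: "'a \<Rightarrow> real"
  assumes P0: "prob_space P0" and X: "integrable P0 X" and \<phi>: "\<phi>1 \<in> Phi0" "\<phi>2 \<in> Phi0"
    and "0 < r" and "\<theta> < \<theta>'"
    and w: "integrable P0 w" "AE \<omega> in P0. persp_sup \<phi>1 1 (- \<theta> - X \<omega>) = ereal (w \<omega>)"
    and h: "integrable P0 h" "AE \<omega> in P0. persp_sup \<phi>2 0 (w \<omega> + \<theta>1) = ereal (h \<omega>)" "(\<integral>\<omega>. h \<omega> \<partial>P0) \<le> \<theta>1"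
  shows "\<exists>\<eta> \<tau>. 0 \<le> \<eta> \<and> ext_integral P0 (\<lambda>\<omega>.
    persp_conjugate \<phi>2 \<eta> (conjugate \<phi>1 (ereal (- \<theta>' - X \<omega>)) + ereal \<tau>)) \<le> ereal (\<tau> - \<eta> * r)"
proof -
  interpret prob_space P0 by fact
  have [measurable]: "X \<in> borel_measurable P0" using X by auto
  define w' where "w' \<omega> = real_of_ereal (persp_sup \<phi>1 1 (- \<theta>' - X \<omega>))" for \<omega>
  define h' where "h' \<omega> = real_of_ereal (persp_sup \<phi>2 0 (w' \<omega> + \<theta>1))" for \<omega>
  have [measurable]: "w' \<in> borel_measurable P0" unfolding w'_def by measurable
  have [measurable]: "h' \<in> borel_measurable P0" unfolding h'_def by measurable
  have w': "AE \<omega> in P0. persp_sup \<phi>1 1 (- \<theta>' - X \<omega>) = ereal (w' \<omega>) \<and> - \<theta>' - X \<omega> \<le> w' \<omega> \<and> w' \<omega> \<le> w \<omega>"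
    using w(2)
  proof eventually_elim
    case (elim \<omega>)
    have "persp_sup \<phi>1 1 (- \<theta>' - X \<omega>) \<le> ereal (w \<omega>)"
      unfolding elim[symmetric] using \<open>\<theta> < \<theta>'\<close> by (intro persp_sup_mono[OF \<phi>(1)]) simp
    then show ?case
      using persp_sup_ge[OF \<phi>(1), of "- \<theta>' - X \<omega>" 1] unfolding w'_def
      by (cases "persp_sup \<phi>1 1 (- \<theta>' - X \<omega>)") auto
  qed
  then have w'_eq: "AE \<omega> in P0. persp_sup \<phi>1 1 (- \<theta>' - X \<omega>) = ereal (w' \<omega>)" by auto
  have w'_int: "integrable P0 w'"
  proof (rule Bochner_Integration.integrable_bound)
    show "integrable P0 (\<lambda>\<omega>. \<bar>w \<omega>\<bar> + \<bar>- \<theta>' - X \<omega>\<bar>)" using w(1) X by simp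
    show "AE \<omega> in P0. norm (w' \<omega>) \<le> norm (\<bar>w \<omega>\<bar> + \<bar>- \<theta>' - X \<omega>\<bar>)"
      using w' by eventually_elim auto
  qed measurable
  have h': "AE \<omega> in P0. persp_sup \<phi>2 0 (w' \<omega> + \<theta>1) = ereal (h' \<omega>) \<and> w' \<omega> + \<theta>1 \<le> h' \<omega> \<and> h' \<omega> \<le> h \<omega>"
    using w' h(2)
  proof eventually_elim
    case (elim \<omega>)
    have "persp_sup \<phi>2 0 (w' \<omega> + \<theta>1) \<le> ereal (h \<omega>)"
      unfolding elim(2)[symmetric] using elim(1) by (intro persp_sup_mono[OF \<phi>(2)]) simp
    then show ?case
      using persp_sup_ge[OF \<phi>(2), of "w' \<omega> + \<theta>1" 0] unfolding h'_def
      by (cases "persp_sup \<phi>2 0 (w' \<omega> + \<theta>1)") auto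
  qed
  have h'_int: "integrable P0 h'"
  proof (rule Bochner_Integration.integrable_bound)
    show "integrable P0 (\<lambda>\<omega>. \<bar>h \<omega>\<bar> + \<bar>w' \<omega> + \<theta>1\<bar>)" using w'_int h(1) by simp
    show "AE \<omega> in P0. norm (h' \<omega>) \<le> norm (\<bar>h \<omega>\<bar> + \<bar>w' \<omega> + \<theta>1\<bar>)"
      using h' by eventually_elim auto
  qed measurable
  show ?thesis
  proof (cases "expectation h' < \<theta>1")
    case True
    \<comment> \<open>The whole slack is spent on the multiplier: \<open>\<eta> * r\<close> equals
      the gap, and a larger \<open>\<eta>\<close> can only lower the integrand.\<close>
    define \<eta> where "\<eta> = (\<theta>1 - expectation h') / r"
    have "0 < \<eta>" using True \<open>0 < r\<close> by (simp add: \<eta>_def)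
    define k where "k \<omega> = real_of_ereal (persp_sup \<phi>2 \<eta> (w' \<omega> + \<theta>1))" for \<omega>
    have [measurable]: "k \<in> borel_measurable P0" unfolding k_def by measurable
    have k: "AE \<omega> in P0. persp_sup \<phi>2 \<eta> (w' \<omega> + \<theta>1) = ereal (k \<omega>) \<and> w' \<omega> + \<theta>1 \<le> k \<omega> \<and> k \<omega> \<le> h' \<omega>"
      using h'
    proof eventually_elim
      case (elim \<omega>)
      have "persp_sup \<phi>2 \<eta> (w' \<omega> + \<theta>1) \<le> ereal (h' \<omega>)"
        using persp_sup_antimono[of 0 \<eta> \<phi>2 "w' \<omega> + \<theta>1"] elim \<open>0 < \<eta>\<close> by simp
      then show ?case
        using persp_sup_ge[OF \<phi>(2), of "w' \<omega> + \<theta>1" \<eta>] unfolding k_def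
        by (cases "persp_sup \<phi>2 \<eta> (w' \<omega> + \<theta>1)") auto
    qed
    have k_int: "integrable P0 k"
    proof (rule Bochner_Integration.integrable_bound)
      show "integrable P0 (\<lambda>\<omega>. \<bar>h' \<omega>\<bar> + \<bar>w' \<omega> + \<theta>1\<bar>)" using w'_int h'_int by simp
      show "AE \<omega> in P0. norm (k \<omega>) \<le> norm (\<bar>h' \<omega>\<bar> + \<bar>w' \<omega> + \<theta>1\<bar>)"
        using k by eventually_elim auto
    qed measurable
    have "expectation k \<le> expectation h'"
      using k by (intro integral_mono_AE k_int h'_int) auto
    also have "\<dots> = \<theta>1 - \<eta> * r" using \<open>0 < r\<close> by (simp add: \<eta>_def)
    finally show ?thesis
      using ext_integral_risk_pos[OF \<phi> \<open>0 < \<eta>\<close> w'_eq k_int, of \<theta>1] k \<open>0 < \<eta>\<close>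
      by (intro exI[of _ \<eta>] exI[of _ \<theta>1]) auto
  next
    case False
    \<comment> \<open>Without slack, \<open>E[h'] \<ge> \<theta>1 \<ge> E[h]\<close> although
      \<open>h' \<le> h\<close>, so the two agree almost everywhere.\<close>
    have "expectation (\<lambda>\<omega>. h \<omega> - h' \<omega>) = 0"
    proof (rule antisym)
      show "expectation (\<lambda>\<omega>. h \<omega> - h' \<omega>) \<le> 0" using False h h'_int by simp
      show "0 \<le> expectation (\<lambda>\<omega>. h \<omega> - h' \<omega>)" using h' by (intro integral_nonneg_AE) auto
    qed
    moreover have "AE \<omega> in P0. 0 \<le> h \<omega> - h' \<omega>" using h' by auto
    ultimately have eq: "AE \<omega> in P0. h \<omega> - h' \<omega> = 0"
      using integral_nonneg_eq_0_iff_AE[of P0 "\<lambda>\<omega>. h \<omega> - h' \<omega>"] h(1) h'_int by simp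
    have flat: "persp_sup \<phi>1 1 u \<ge> ereal b"
      if "persp_sup \<phi>1 1 (- \<theta>' - X \<omega>) = ereal b" "persp_sup \<phi>1 1 (- \<theta> - X \<omega>) = ereal b" for \<omega> b u
      using that \<open>\<theta> < \<theta>'\<close> by (intro persp_sup_flat_min[OF \<phi>(1), of "- \<theta>' - X \<omega>" "- \<theta> - X \<omega>"]) auto
    \<comment> \<open>Equal values at two distinct points are the minimum of the conjugate of
      \<open>\<phi>1\<close>, so \<open>w'\<close> is almost everywhere constant. That minimum is at
      most the value at 0, hence nonpositive, and its negative is a feasible \<open>\<tau>\<close>
      with \<open>\<eta> = 0\<close>.\<close>
    have const: ?thesis if "AE \<omega> in P0. w' \<omega> = w \<omega>"
    proof -
      have "AE \<omega> in P0. persp_sup \<phi>1 1 (- \<theta>' - X \<omega>) = ereal (w' \<omega>) \<and> persp_sup \<phi>1 1 (- \<theta> - X \<omega>) = ereal (w' \<omega>)"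
        using that w'_eq w(2) by eventually_elim auto
      then have min: "AE \<omega> in P0. \<forall>u. ereal (w' \<omega>) \<le> persp_sup \<phi>1 1 u"
        by eventually_elim (use flat in blast)
      obtain \<omega>0 where \<omega>0: "persp_sup \<phi>1 1 (- \<theta>' - X \<omega>0) = ereal (w' \<omega>0)" "\<forall>u. ereal (w' \<omega>0) \<le> persp_sup \<phi>1 1 u"
      proof -
        have "AE \<omega> in P0. persp_sup \<phi>1 1 (- \<theta>' - X \<omega>) = ereal (w' \<omega>) \<and> (\<forall>u. ereal (w' \<omega>) \<le> persp_sup \<phi>1 1 u)"
          using w'_eq min by eventually_elim auto
        from eventually_happens[OF this] ae_filter_bot show thesis using that by blast
      qed
      have "AE \<omega> in P0. w' \<omega> + - w' \<omega>0 \<le> 0"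
        using min
      proof eventually_elim
        case (elim \<omega>)
        then have "ereal (w' \<omega>) \<le> ereal (w' \<omega>0)" using \<omega>0(1) by metis
        then show ?case by simp
      qed
      moreover have "w' \<omega>0 \<le> 0"
      proof -
        have "ereal (w' \<omega>0) \<le> 0" using \<omega>0(2) persp_sup_one_zero[of \<phi>1] by (meson order_trans)
        then show ?thesis by simp
      qed
      ultimately show ?thesis
        using ext_integral_risk_zero[OF \<phi>(1) w'_eq, of "- w' \<omega>0" \<phi>2]
        by (intro exI[of _ 0] exI[of _ "- w' \<omega>0"]) auto
    qed
    show ?thesis
    \<comment> \<open>If the domain of \<open>\<phi>2\<close> stays away from 0, the support
      function is injective where finite, and \<open>h' = h\<close> gives \<open>w' = w\<close>.
      Otherwise it is nonnegative, so \<open>\<theta>1 \<ge> 0\<close>, but injectivity is available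
      only at positive arguments.\<close>
    proof (cases "\<exists>a>0. \<forall>t \<in> rat_dom \<phi>2. a \<le> t")
      case True
      then obtain a where a: "0 < a" "\<And>t. t \<in> rat_dom \<phi>2 \<Longrightarrow> a \<le> t" by auto
      have "AE \<omega> in P0. w' \<omega> = w \<omega>"
        using eq w' h' h(2)
      proof eventually_elim
        case (elim \<omega>)
        then show ?case
          using persp_sup_zero_inj_lower_bound[OF \<phi>(2) a, of "w' \<omega> + \<theta>1" "w \<omega> + \<theta>1" "h \<omega>"] by simp
      qed
      then show ?thesis by (rule const)
    next
      case False
      then have small: "\<exists>t \<in> rat_dom \<phi>2. t < a" if "0 < a" for a using that by (meson not_le)
      have "AE \<omega> in P0. 0 \<le> h \<omega>"
        using h(2)
      proof eventually_elim
        case (elim \<omega>)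
        then show ?case using persp_sup_zero_nonneg[OF \<phi>(2) small, of "w \<omega> + \<theta>1"] by simp
      qed
      then have "0 \<le> expectation h" by (rule integral_nonneg_AE)
      then have "0 \<le> \<theta>1" using h(3) by simp
      have pos: "AE \<omega> in P0. 0 < w \<omega> + \<theta>1 \<longrightarrow> w' \<omega> = w \<omega>"
        using eq w' h' h(2)
      proof eventually_elim
        case (elim \<omega>)
        then show ?case
          using persp_sup_zero_inj_pos[OF \<phi>(2), of "w \<omega> + \<theta>1" "w' \<omega> + \<theta>1" "h \<omega>"] by simp
      qed
      show ?thesis
      proof (cases "AE \<omega> in P0. w \<omega> + \<theta>1 \<le> 0")
        case True
        then have "AE \<omega> in P0. w' \<omega> + \<theta>1 \<le> 0" using w' by eventually_elim auto
        then show ?thesis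
          using ext_integral_risk_zero[OF \<phi>(1) w'_eq, of \<theta>1 \<phi>2] \<open>0 \<le> \<theta>1\<close>
          by (intro exI[of _ 0] exI[of _ \<theta>1]) auto
      next
        case False
        have good: "AE \<omega> in P0. 0 < w \<omega> + \<theta>1 \<longrightarrow>
          persp_sup \<phi>1 1 (- \<theta>' - X \<omega>) = ereal (w \<omega>) \<and> persp_sup \<phi>1 1 (- \<theta> - X \<omega>) = ereal (w \<omega>)"
          using pos w'_eq w(2) by eventually_elim auto
        have "\<exists>\<omega>. 0 < w \<omega> + \<theta>1 \<and>
          persp_sup \<phi>1 1 (- \<theta>' - X \<omega>) = ereal (w \<omega>) \<and> persp_sup \<phi>1 1 (- \<theta> - X \<omega>) = ereal (w \<omega>)"
        proof (rule ccontr)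
          assume "\<not> ?thesis"
          with good have "AE \<omega> in P0. w \<omega> + \<theta>1 \<le> 0"
            by (auto elim!: eventually_mono simp: not_less)
          with False show False by simp
        qed
        \<comment> \<open>One such point suffices: \<open>w \<omega>0\<close> is a lower bound of
          the conjugate of \<open>\<phi>1\<close>, so \<open>w + \<theta>1\<close> is positive
          almost everywhere and injectivity applies throughout.\<close>
        then obtain \<omega>0 where \<omega>0: "0 < w \<omega>0 + \<theta>1" "\<And>u. ereal (w \<omega>0) \<le> persp_sup \<phi>1 1 u"
          using flat by blast
        have "AE \<omega> in P0. w' \<omega> = w \<omega>"
          using pos w(2)
        proof eventually_elim
          case (elim \<omega>)
          have "w \<omega>0 \<le> w \<omega>" using \<omega>0(2)[of "- \<theta> - X \<omega>"] elim(2) by simp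
          then show ?case using elim(1) \<omega>0(1) by simp
        qed
        then show ?thesis by (rule const)
      qed
    qed
  qed
qed

text \<open>The conclusion leaves room for \<open>\<theta>2 \<le> \<theta>'\<close> because a
  positive multiplier works at \<open>\<theta>\<close> itself, whereas a vanishing one is repaired
  at \<open>\<theta>'\<close>.\<close>

lemma strong_duality:
  fixes X :: "'a \<Rightarrow> real"
  assumes P0: "prob_space P0" and X: "integrable P0 X" and \<phi>: "\<phi>1 \<in> Phi0" "\<phi>2 \<in> Phi0" and "0 < r"
    and \<rho>: "robust_shortfall P0 \<phi>1 \<phi>2 r X \<le> ereal \<theta>" and "\<theta> < \<theta>'"
  shows "\<exists>\<eta> \<theta>1 \<theta>2. 0 \<le> \<eta> \<and> \<theta>2 \<le> \<theta>' \<and> ext_integral P0 (\<lambda>\<omega>.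
    persp_conjugate \<phi>2 \<eta> (conjugate \<phi>1 (ereal (- \<theta>2 - X \<omega>)) + ereal \<theta>1)) \<le> ereal (\<theta>1 - \<eta> * r)"
proof -
  interpret prob_space P0 by fact
  obtain w where w: "integrable P0 w" "AE \<omega> in P0. persp_sup \<phi>1 1 (- \<theta> - X \<omega>) = ereal (w \<omega>)"
    and opt: "\<And>g. g \<in> simple_weights P0 \<phi>2 \<Longrightarrow> expectation g = 1 \<Longrightarrow>
      expectation (\<lambda>\<omega>. enn2real (\<phi>2 (g \<omega>))) \<le> r \<Longrightarrow> expectation (\<lambda>\<omega>. g \<omega> * w \<omega>) \<le> 0"
    using robust_shortfall_le_imp_conjugate[OF P0 X \<phi> less_imp_le[OF \<open>0 < r\<close>] \<rho>] by blast
  obtain \<eta> \<theta>1 where "0 \<le> \<eta>" and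
    mult: "\<And>g. g \<in> simple_weights P0 \<phi>2 \<Longrightarrow>
      expectation (\<lambda>\<omega>. g \<omega> * (w \<omega> + \<theta>1) - \<eta> * enn2real (\<phi>2 (g \<omega>))) \<le> \<theta>1 - \<eta> * r"
    using Lagrange_multipliers[OF \<phi>(2) \<open>0 < r\<close> w(1) opt] by blast
  have "integrable P0 (\<lambda>\<omega>. w \<omega> + \<theta>1)" using w(1) by simp
  from integral_persp_sup_le[OF \<phi>(2) this mult]
  obtain h where h: "integrable P0 h" "AE \<omega> in P0. persp_sup \<phi>2 \<eta> (w \<omega> + \<theta>1) = ereal (h \<omega>)"
    "expectation h \<le> \<theta>1 - \<eta> * r" by blast
  show ?thesis
  proof (cases "\<eta> = 0")
    case True
    with h have "AE \<omega> in P0. persp_sup \<phi>2 0 (w \<omega> + \<theta>1) = ereal (h \<omega>)" "expectation h \<le> \<theta>1" by auto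
    from feasible_of_zero_multiplier[OF P0 X \<phi> \<open>0 < r\<close> \<open>\<theta> < \<theta>'\<close> w h(1) this] show ?thesis by blast
  next
    case False
    then have "0 < \<eta>" using \<open>0 \<le> \<eta>\<close> by simp
    then show ?thesis
      using ext_integral_risk_pos[OF \<phi> \<open>0 < \<eta>\<close> w(2) h(1,2)] h(3) \<open>\<theta> < \<theta>'\<close>
      by (intro exI[of _ \<eta>] exI[of _ \<theta>1] exI[of _ \<theta>]) auto
  qed
qed

text \<open>The choice \<open>Q = Q' = P0\<close> with scale 1 is admissible at zero penalty. It
  excludes the value \<open>- \<infinity>\<close>, so finiteness of the risk amounts to an upper
  bound.\<close>

lemma expectation_le_robust_shortfall:
  fixes X :: "'a \<Rightarrow> real"
  assumes P0: "prob_space P0" and X: "integrable P0 X" and \<phi>: "\<phi>1 \<in> Phi0" "\<phi>2 \<in> Phi0"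
  shows "ereal (\<integral>\<omega>. - X \<omega> \<partial>P0) \<le> robust_shortfall P0 \<phi>1 \<phi>2 r X"
proof -
  interpret prob_space P0 by fact
  have div: "divergence \<psi> P0 P0 = 0" if "\<psi> 1 = 0" for \<psi>
    using divergence_density[OF P0, of "\<lambda>_. 1" \<psi>] that by (simp add: density_1)
  have "low_diff (ext_integral P0 (\<lambda>\<omega>. ereal (- X \<omega>))) (divergence (scaled 1 \<phi>1) P0 P0)
    \<le> robust_shortfall P0 \<phi>1 \<phi>2 r X"
    using P0 by (intro robust_shortfall_upper)
      (auto simp: prob_measures_on_def div Phi0_one[OF \<phi>(2)] absolutely_continuous_def)
  moreover have "ext_integral P0 (\<lambda>\<omega>. ereal (- X \<omega>)) = ereal (\<integral>\<omega>. - X \<omega> \<partial>P0)"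
    using X by (intro ext_integral_eq_integral) auto
  moreover have "divergence (scaled 1 \<phi>1) P0 P0 = 0"
    by (rule div) (simp add: scaled_def Phi0_one[OF \<phi>(1)])
  ultimately show ?thesis by (simp add: low_diff_def zero_ennreal.rep_eq)
qed

theorem theorem2:
  fixes P0 :: "'a measure" and X :: "'a \<Rightarrow> real"
    and \<phi>1 \<phi>2 :: "real \<Rightarrow> ennreal" and r :: real
    and \<nu> :: "real measure" and f0 :: "real \<Rightarrow> real"
  assumes "prob_space P0"
    and "integrable P0 X"
    and "\<phi>1 \<in> Phi0" and "lower_semicont \<phi>1"
    and "\<phi>2 \<in> Phi0" and "lower_semicont \<phi>2"
    and "r > 0"
    and "sigma_finite_measure \<nu>" and "sets \<nu> = sets borel"
    and "\<And>x. 0 \<le> f0 x"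
    and "distributed P0 \<nu> X (\<lambda>x. ennreal (f0 x))"
  shows "(\<bar>robust_shortfall P0 \<phi>1 \<phi>2 r X\<bar> \<noteq> \<infinity> \<longleftrightarrow>
           (\<exists>\<theta>1 \<theta>2 \<eta>. 0 \<le> \<eta> \<and>
             ext_integral \<nu> (\<lambda>x.
               persp_conjugate \<phi>2 \<eta> (conjugate \<phi>1 (ereal (- \<theta>2 - x)) + ereal \<theta>1) * ereal (f0 x))
             \<le> ereal (\<theta>1 - \<eta> * r)))
       \<and> robust_shortfall P0 \<phi>1 \<phi>2 r X =
           Inf {ereal \<theta>2 | \<eta> \<theta>1 \<theta>2. 0 \<le> \<eta> \<and>
             ext_integral P0 (\<lambda>\<omega>.
               persp_conjugate \<phi>2 \<eta> (conjugate \<phi>1 (ereal (- \<theta>2 - X \<omega>)) + ereal \<theta>1))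
             \<le> ereal (\<theta>1 - \<eta> * r)}"
proof -
  note P0 = assms(1) and X = assms(2) and \<phi> = assms(3,5)
  let ?E = "\<lambda>\<eta> \<theta>1 \<theta>2. ext_integral P0 (\<lambda>\<omega>.
    persp_conjugate \<phi>2 \<eta> (conjugate \<phi>1 (ereal (- \<theta>2 - X \<omega>)) + ereal \<theta>1))"
  let ?I = "Inf {ereal \<theta>2 | \<eta> \<theta>1 \<theta>2. 0 \<le> \<eta> \<and> ?E \<eta> \<theta>1 \<theta>2 \<le> ereal (\<theta>1 - \<eta> * r)}"
  let ?\<rho> = "robust_shortfall P0 \<phi>1 \<phi>2 r X"
  have weak: "?\<rho> \<le> ereal \<theta>2" if "0 \<le> \<eta>" "?E \<eta> \<theta>1 \<theta>2 \<le> ereal (\<theta>1 - \<eta> * r)" for \<eta> \<theta>1 \<theta>2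
    unfolding robust_shortfall_def
    using weak_duality[OF P0 X \<phi> _ that(1) _ that(2)] \<open>r > 0\<close>
    by (intro SUP_least) (auto simp: prob_measures_on_def)
  have lower: "?\<rho> \<noteq> - \<infinity>"
    using expectation_le_robust_shortfall[OF P0 X \<phi>, of r] by auto
  have eq: "?\<rho> = ?I"
  proof (rule antisym)
    show "?\<rho> \<le> ?I" using weak by (intro Inf_greatest) auto
    show "?I \<le> ?\<rho>"
    proof (cases ?\<rho>)
      case (real \<rho>)
      show ?thesis unfolding real
      \<comment> \<open>Feasible points are available only strictly above the risk, so the infimum
        is approached within every \<open>e\<close> rather than attained.\<close>
      proof (rule ereal_le_epsilon2)
        fix e :: real assume "0 < e"
        then obtain \<eta> \<theta>1 \<theta>2 where "0 \<le> \<eta>" "\<theta>2 \<le> \<rho> + e" "?E \<eta> \<theta>1 \<theta>2 \<le> ereal (\<theta>1 - \<eta> * r)"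
          using strong_duality[OF P0 X \<phi> \<open>r > 0\<close>, of \<rho> "\<rho> + e"] real by auto
        then show "?I \<le> ereal \<rho> + ereal e"
          by (intro Inf_lower2[of "ereal \<theta>2"]) auto
      qed
    qed (use lower in auto)
  qed
  have dens: "ext_integral \<nu> (\<lambda>x.
      persp_conjugate \<phi>2 \<eta> (conjugate \<phi>1 (ereal (- \<theta>2 - x)) + ereal \<theta>1) * ereal (f0 x)) = ?E \<eta> \<theta>1 \<theta>2"
    if "0 \<le> \<eta>" for \<eta> \<theta>1 \<theta>2
  proof (rule ext_integral_distributed[OF assms(11,10)])
    show "(\<lambda>x. persp_conjugate \<phi>2 \<eta> (conjugate \<phi>1 (ereal (- \<theta>2 - x)) + ereal \<theta>1)) \<in> borel_measurable \<nu>"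
      using borel_measurable_risk_integrand[OF \<phi> that] assms(9) by (simp cong: measurable_cong_sets)
  qed
  have "\<bar>?\<rho>\<bar> \<noteq> \<infinity> \<longleftrightarrow> (\<exists>\<theta>1 \<theta>2 \<eta>. 0 \<le> \<eta> \<and> ?E \<eta> \<theta>1 \<theta>2 \<le> ereal (\<theta>1 - \<eta> * r))"
  proof
    assume "\<bar>?\<rho>\<bar> \<noteq> \<infinity>"
    then obtain \<rho> where "?\<rho> = ereal \<rho>" by (cases ?\<rho>) auto
    then show "\<exists>\<theta>1 \<theta>2 \<eta>. 0 \<le> \<eta> \<and> ?E \<eta> \<theta>1 \<theta>2 \<le> ereal (\<theta>1 - \<eta> * r)"
      using strong_duality[OF P0 X \<phi> \<open>r > 0\<close>, of \<rho> "\<rho> + 1"] by auto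
  next
    assume "\<exists>\<theta>1 \<theta>2 \<eta>. 0 \<le> \<eta> \<and> ?E \<eta> \<theta>1 \<theta>2 \<le> ereal (\<theta>1 - \<eta> * r)"
    then obtain \<theta>2 where "?\<rho> \<le> ereal \<theta>2" using weak by blast
    then show "\<bar>?\<rho>\<bar> \<noteq> \<infinity>" using lower by (cases ?\<rho>) auto
  qed
  then show ?thesis using eq dens by (simp cong: conj_cong)
qed

end
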